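(* Let $\hat{A} \in \mathbb{D}\mathbb{C}^{m \times q}$ and $\hat{B} \in \mathbb{D}\mathbb{C}^{q \times n}$ be dual complex matrices. If $$\hat{A}^N\hat{A}\hat{B}\hat{B}^*\hat{A}^*=\hat{B}\hat{B}^*\hat{A}^* \quad\text{and}\quad \hat{B}\hat{B}^N\hat{A}^*\hat{A}\hat{B}=\hat{A}^*\hat{A}\hat{B},$$ then $(\hat{A}\hat{B})^N=\hat{B}^N\hat{A}^N$.
   Context: A dual complex number is $\hat a=a_s+a_d\epsilon$ with $a_s,a_d\in\mathbb{C}$, where $\epsilon$ commutes with complex numbers and $\epsilon^2=0$; it is a dual number if $a_s,a_d\in\mathbb{R}$. A dual number is positive appreciable if $a_s>0$, and positive infinitesimal if $a_s=0$ and $a_d>0$. $\mathbb{D}\mathbb{C}^{m\times n}$ is the set of $m\times n$ dual complex matrices $\hat A=A_s+A_d\epsilon$, $A_s,A_d\in\mathbb{C}^{m\times n}$, and $\hat A^*=A_s^*+A_d^*\epsilon$ (conjugate transpose). $\hat U$ (square) is unitary if $\hat U^*\hat U=\hat U\hat U^*=I$. Known fact (SVD): every $\hat A\in\mathbb{D}\mathbb{C}^{m\times n}$ can be written $\hat A=\hat U\begin{bmatrix}\hat\Sigma_1&O\\O&\hat\Sigma_2\end{bmatrix}\hat V^*$ with $\hat U\in\mathbb{D}\mathbb{C}^{m\times m}$, $\hat V\in\mathbb{D}\mathbb{C}^{n\times n}$ unitary, $\hat\Sigma_1=\mathrm{diag}(\hat\mu_1,\dots,\hat\mu_r)$ with positive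 appreciable dual numbers on the diagonal, and $\hat\Sigma_2$ a (rectangular) diagonal matrix with diagonal entries that are positive infinitesimal dual numbers or zero. The essential part of $\hat A$ is $\hat A_e=\hat U\begin{bmatrix}\hat\Sigma_1&O\\O&O\end{bmatrix}\hat V^*$. The new dual Moore-Penrose inverse (NDMPI) $\hat A^N\in\mathbb{D}\mathbb{C}^{n\times m}$ of $\hat A$ is the unique $\hat X$ (known to exist for every $\hat A$) satisfying $\hat A\hat X\hat A=\hat A_e$, $\hat X\hat A\hat X=\hat X$, $(\hat A\hat X)^*=\hat A\hat X$, $(\hat X\hat A)^*=\hat X\hat A$; in terms of the SVD, $\hat A^N=\hat V\begin{bmatrix}\hat\Sigma_1^{-1}&O\\O&O\end{bmatrix}\hat U^*$. *)

theory Defs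
  imports Complex_Main "Jordan_Normal_Form.Matrix" "Jordan_Normal_Form.Conjugate"
begin

section \<open>Dual complex numbers\<close>

datatype dual_complex = Dual (std_part: complex) (inf_part: complex)

instantiation dual_complex :: comm_ring_1
begin

definition "0 = Dual 0 0"
definition "1 = Dual 1 0"
definition "x + y = Dual (std_part x + std_part y) (inf_part x + inf_part y)"
definition "- x = Dual (- std_part x) (- inf_part x)"
definition "x - y = Dual (std_part x - std_part y) (inf_part x - inf_part y)"
definition "x * y = Dual (std_part x * std_part y)
                         (std_part x * inf_part y + inf_part x * std_part y)"

instance
  by intro_classes
    (auto simp: zero_dual_complex_def one_dual_complex_def plus_dual_complex_def
       uminus_dual_complex_def minus_dual_complex_def times_dual_complex_def algebra_simps)

end

definition dual_eps :: dual_complex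
  where "dual_eps = Dual 0 1"

lemma dual_eps_squared: "dual_eps * dual_eps = 0"
  by (simp add: dual_eps_def times_dual_complex_def zero_dual_complex_def)

lemma Dual_eq: "Dual a b = Dual a 0 + Dual b 0 * dual_eps"
  by (simp add: dual_eps_def times_dual_complex_def plus_dual_complex_def)

instantiation dual_complex :: conjugatable_ring
begin

definition "conjugate x = Dual (cnj (std_part x)) (cnj (inf_part x))"

instance
  by intro_classes
    (auto simp: conjugate_dual_complex_def zero_dual_complex_def plus_dual_complex_def
       uminus_dual_complex_def times_dual_complex_def intro: dual_complex.expand)

end

definition is_dual_number :: "dual_complex \<Rightarrow> bool"
  where "is_dual_number x \<longleftrightarrow> std_part x \<in> \<real> \<and> inf_part x \<in> \<real>"

definition positive_appreciable :: "dual_complex \<Rightarrow> bool"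
  where "positive_appreciable x \<longleftrightarrow> is_dual_number x \<and> Re (std_part x) > 0"

definition positive_infinitesimal :: "dual_complex \<Rightarrow> bool"
  where "positive_infinitesimal x \<longleftrightarrow>
    is_dual_number x \<and> std_part x = 0 \<and> Re (inf_part x) > 0"


section \<open>Dual complex matrices\<close>

text \<open>A dual complex matrix \<open>A\<^sub>s + A\<^sub>d \<epsilon>\<close> is a matrix with dual complex entries;
  \<open>map_mat std_part\<close> and \<open>map_mat inf_part\<close> give \<open>A\<^sub>s\<close> and \<open>A\<^sub>d\<close>.
  The library's \<open>mat_adjoint\<close> is restricted to fields, hence the version below.\<close>

definition ctranspose :: "'a :: conjugatable_ring mat \<Rightarrow> 'a mat"
  where "ctranspose A = map_mat conjugate (transpose_mat A)"

lemma map_mat_std_part_ctranspose: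
  "map_mat std_part (ctranspose A) = ctranspose (map_mat std_part A)"
  by (rule eq_matI) (auto simp: ctranspose_def conjugate_dual_complex_def)

lemma map_mat_inf_part_ctranspose:
  "map_mat inf_part (ctranspose A) = ctranspose (map_mat inf_part A)"
  by (rule eq_matI) (auto simp: ctranspose_def conjugate_dual_complex_def)

definition unitary_mat :: "dual_complex mat \<Rightarrow> bool"
  where "unitary_mat U \<longleftrightarrow> square_mat U \<and>
    ctranspose U * U = 1\<^sub>m (dim_row U) \<and> U * ctranspose U = 1\<^sub>m (dim_row U)"

text \<open>\<open>dual_svd A r U S1 S2 V\<close>: the matrices form a singular value decomposition of \<open>A\<close>
  with \<open>r\<close> positive appreciable singular values. The block \<open>S2\<close> is rectangular, and
  blocks may be empty.\<close>

definition dual_svd ::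
  "dual_complex mat \<Rightarrow> nat \<Rightarrow> dual_complex mat \<Rightarrow> dual_complex mat \<Rightarrow> dual_complex mat
     \<Rightarrow> dual_complex mat \<Rightarrow> bool"
  where "dual_svd A r U S1 S2 V \<longleftrightarrow>
    (let m = dim_row A; n = dim_col A in
      r \<le> m \<and> r \<le> n \<and>
      U \<in> carrier_mat m m \<and> unitary_mat U \<and>
      V \<in> carrier_mat n n \<and> unitary_mat V \<and>
      S1 \<in> carrier_mat r r \<and> diagonal_mat S1 \<and>
      (\<forall>i<r. positive_appreciable (S1 $$ (i, i))) \<and>
      S2 \<in> carrier_mat (m - r) (n - r) \<and> diagonal_mat S2 \<and>
      (\<forall>i<min (m - r) (n - r).
         positive_infinitesimal (S2 $$ (i, i)) \<or> S2 $$ (i, i) = 0) \<and>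
      A = U * four_block_mat S1 (0\<^sub>m r (n - r)) (0\<^sub>m (m - r) r) S2 * ctranspose V)"

text \<open>The essential part does not depend on the chosen decomposition.\<close>

definition essential_part :: "dual_complex mat \<Rightarrow> dual_complex mat"
  where "essential_part A = (THE E. \<exists>r U S1 S2 V. dual_svd A r U S1 S2 V \<and>
    E = U * four_block_mat S1 (0\<^sub>m r (dim_col A - r)) (0\<^sub>m (dim_row A - r) r)
              (0\<^sub>m (dim_row A - r) (dim_col A - r)) * ctranspose V)"

definition is_ndmpi :: "dual_complex mat \<Rightarrow> dual_complex mat \<Rightarrow> bool"
  where "is_ndmpi A X \<longleftrightarrow>
    X \<in> carrier_mat (dim_col A) (dim_row A) \<and>
    A * X * A = essential_part A \<and>
    X * A * X = X \<and>
    ctranspose (A * X) = A * X \<and>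
    ctranspose (X * A) = X * A"

text \<open>The new dual Moore-Penrose inverse.\<close>

definition ndmpi :: "dual_complex mat \<Rightarrow> dual_complex mat"
  where "ndmpi A = (THE X. is_ndmpi A X)"

end

theory Submission
  imports Defs "Jordan_Normal_Form.Spectral_Radius"
begin

text \<open>The Penrose equation \<open>AXA = A\<^sub>e\<close> refers to the singular value decomposition, but it is equivalent,
  in the presence of the other three, to \<open>A\<^sup>*AXA = A\<^sup>*A\<close> and \<open>AXAA\<^sup>* = AA\<^sup>*\<close>: the part
  \<open>A - A\<^sub>e\<close> is orthogonal to \<open>A\<^sub>e\<close> and a product of two infinitesimal matrices vanishes. With these purely
  algebraic equations the reverse order law is proved as for complex matrices: the hypotheses say that the
  projections \<open>A\<^sup>NA\<close> and \<open>BB\<^sup>N\<close> commute with \<open>BB\<^sup>*\<close> and \<open>A\<^sup>*A\<close> respectively, hence with their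
  pseudo-inverses and with each other.

  The singular value decomposition itself is obtained by first bringing the standard part to diagonal form,
  then decoupling distinct singular values by an infinitesimal rotation, and finally diagonalising
  the remaining blocks of the infinitesimal part over the complex numbers.\<close>

section \<open>Algebraic characterisation of the inverse and reverse order law\<close>

lemma mult_assoc_dim:
  fixes A B C :: "'a::semiring_0 mat"
  shows "dim_col A = dim_row B \<Longrightarrow> dim_col B = dim_row C \<Longrightarrow> A * B * C = A * (B * C)"
  by (rule assoc_mult_mat[of A "dim_row A" "dim_row B" B "dim_row C" C "dim_col C"]) auto

lemma dim_ctranspose [simp]:
  "dim_row (ctranspose A) = dim_col A" "dim_col (ctranspose A) = dim_row A"
  by (simp_all add: ctranspose_def)

lemma carrier_mat_iff: "A \<in> carrier_mat m n \<longleftrightarrow> dim_row A = m \<and> dim_col A = n"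
  by blast

lemma ctranspose_carrier [simp]: "ctranspose A \<in> carrier_mat n m \<longleftrightarrow> A \<in> carrier_mat m n"
  unfolding carrier_mat_iff by (metis dim_ctranspose)

lemma index_ctranspose [simp]:
  "i < dim_col A \<Longrightarrow> j < dim_row A \<Longrightarrow> ctranspose A $$ (i, j) = conjugate (A $$ (j, i))"
  by (simp add: ctranspose_def)

lemma ctranspose_ctranspose [simp]: "ctranspose (ctranspose A) = A"
  by (rule eq_matI) auto

lemma conjugate_one [simp]: "conjugate (1 :: 'a::{conjugatable_ring, ring_1}) = 1"
  by (metis conjugate_dist_mul conjugate_id mult.left_neutral mult.right_neutral)

lemma ctranspose_one [simp]: "ctranspose (1\<^sub>m n :: 'a::{conjugatable_ring, ring_1} mat) = 1\<^sub>m n"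
  by (rule eq_matI) auto

lemma ctranspose_zero [simp]: "ctranspose (0\<^sub>m m n :: 'a::conjugatable_ring mat) = 0\<^sub>m n m"
  by (rule eq_matI) auto

lemma ctranspose_mult:
  fixes A B :: "'a::{conjugatable_ring, comm_ring} mat"
  assumes "dim_col A = dim_row B"
  shows "ctranspose (A * B) = ctranspose B * ctranspose A"
  by (rule eq_matI)
    (use assms in \<open>auto simp: scalar_prod_def sum_conjugate conjugate_dist_mul mult.commute\<close>)

lemma ctranspose_four_block:
  fixes A B C D :: "'a::conjugatable_ring mat"
  assumes "A \<in> carrier_mat a c" "B \<in> carrier_mat a d" "C \<in> carrier_mat b c" "D \<in> carrier_mat b d"
  shows "ctranspose (four_block_mat A B C D) =
    four_block_mat (ctranspose A) (ctranspose C) (ctranspose B) (ctranspose D)"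
  by (rule eq_matI) (use assms in auto)

section \<open>Penrose equations weakened by adjoint factors\<close>

text \<open>The equation \<open>A * X * A = A\<close> would be too strong: it fails for a dual
  matrix with a nonzero infinitesimal singular value. Multiplied by the adjoint of \<open>A\<close>,
  from the left and from the right, it leaves conditions that such a matrix can satisfy and that
  mention no decomposition.\<close>

definition weak_mp_inverse :: "'a::{conjugatable_ring, comm_ring_1} mat \<Rightarrow> 'a mat \<Rightarrow> bool" where
  "weak_mp_inverse A X \<longleftrightarrow>
    X \<in> carrier_mat (dim_col A) (dim_row A) \<and>
    X * A * X = X \<and> ctranspose (A * X) = A * X \<and> ctranspose (X * A) = X * A \<and>
    ctranspose A * A * X * A = ctranspose A * A \<and> A * X * A * ctranspose A = A * ctranspose A"

locale weak_mp_pair =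
  fixes A X :: "'a::{conjugatable_ring, comm_ring_1} mat" and m n :: nat
  assumes A: "A \<in> carrier_mat m n" and mp: "weak_mp_inverse A X"
begin

lemma dims [simp]: "dim_row A = m" "dim_col A = n" "dim_row X = n" "dim_col X = m"
  using A mp by (auto simp: weak_mp_inverse_def)

text \<open>The defining equations as rewrite rules: products are nested to the right, and adjacent
  adjoints of \<open>A\<close> and \<open>X\<close> are traded for \<open>A * X\<close> or
  \<open>X * A\<close>.\<close>

lemma mult_eqs:
  "X * (A * X) = X"
  "ctranspose X * ctranspose A = A * X"
  "ctranspose A * ctranspose X = X * A"
  "ctranspose A * (A * (X * A)) = ctranspose A * A"
  "A * (X * (A * ctranspose A)) = A * ctranspose A"
  using mp unfolding weak_mp_inverse_def by (simp_all add: ctranspose_mult mult_assoc_dim)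

text \<open>In a product nested to the right, the left-hand sides of \<open>mult_eqs\<close> can
  match only at the very end; the variants with a trailing factor \<open>Z\<close> apply further
  inside.\<close>

lemma mult_eqs_left:
  "dim_row Z = m \<Longrightarrow> X * (A * (X * Z)) = X * Z"
  "dim_row Z = m \<Longrightarrow> ctranspose X * (ctranspose A * Z) = A * (X * Z)"
  "dim_row Z = n \<Longrightarrow> ctranspose A * (ctranspose X * Z) = X * (A * Z)"
  "dim_row Z = n \<Longrightarrow> ctranspose A * (A * (X * (A * Z))) = ctranspose A * (A * Z)"
  "dim_row Z = m \<Longrightarrow> A * (X * (A * (ctranspose A * Z))) = A * (ctranspose A * Z)"
  using mult_eqs[THEN arg_cong, of "\<lambda>M. M * Z"] by (simp_all add: mult_assoc_dim)

lemma adjoint_eqs: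
  "A * (X * ctranspose X) = ctranspose X"
  "ctranspose X * (X * A) = ctranspose X"
  "X * (A * (ctranspose A * A)) = ctranspose A * A"
  "A * (ctranspose A * (A * X)) = A * ctranspose A"
proof -
  have *: "ctranspose X * (ctranspose A * ctranspose X) = ctranspose X"
    using arg_cong[OF mult_eqs(1), of ctranspose] by (simp add: ctranspose_mult mult_assoc_dim)
  show "ctranspose X * (X * A) = ctranspose X" using * by (simp only: mult_eqs(3))
  show "A * (X * ctranspose X) = ctranspose X" using * by (simp only: mult_eqs_left(2) dims dim_ctranspose)
  show "X * (A * (ctranspose A * A)) = ctranspose A * A"
    using arg_cong[OF mult_eqs(4), of ctranspose]
    by (simp add: ctranspose_mult mult_assoc_dim mult_eqs_left(3))
  show "A * (ctranspose A * (A * X)) = A * ctranspose A"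
    using arg_cong[OF mult_eqs(5), of ctranspose]
    by (simp add: ctranspose_mult mult_assoc_dim mult_eqs(2))
qed

text \<open>Put \<open>H = ctranspose A * A\<close>, \<open>K = X * ctranspose X\<close> and
  \<open>P = X * A\<close>; then \<open>H * K = K * H = P\<close>, \<open>P * H = H\<close> and
  \<open>K * P = P * K = K\<close>. From \<open>Q * P = Q * H * K = H * Q * K\<close> follows
  \<open>P * Q * P = Q * P\<close>, whose left side is Hermitian, so \<open>Q\<close> and
  \<open>P\<close> commute. Hence \<open>K * Q = K * P * Q = K * Q * P = K * H * Q * K = P * Q * K =
  Q * P * K = Q * K\<close>.\<close>

lemma commute_pseudo_inverse:
  assumes Q: "Q \<in> carrier_mat n n" "ctranspose Q = Q"
    and comm: "Q * (ctranspose A * A) = ctranspose A * (A * Q)"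
  shows "Q * (X * A) = X * (A * Q)" "X * (ctranspose X * Q) = Q * (X * ctranspose X)"
proof -
  have [simp]: "dim_row Q = n" "dim_col Q = n" using Q by auto
  have QP: "Q * (X * A) = ctranspose A * (A * (Q * (X * ctranspose X)))"
  proof -
    have "Q * (X * A) = Q * (ctranspose A * A) * (X * ctranspose X)"
      by (simp add: mult_assoc_dim adjoint_eqs mult_eqs)
    then show ?thesis unfolding comm by (simp add: mult_assoc_dim)
  qed
  have PQP: "X * (A * (Q * (X * A))) = Q * (X * A)"
    unfolding QP using arg_cong[OF adjoint_eqs(3), of "\<lambda>M. M * (Q * (X * ctranspose X))"]
    by (simp add: mult_assoc_dim)
  have "ctranspose (X * (A * (Q * (X * A)))) = X * (A * (Q * (X * A)))"
    by (simp add: ctranspose_mult mult_assoc_dim mult_eqs mult_eqs_left Q(2))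
  then show QP': "Q * (X * A) = X * (A * Q)"
    unfolding PQP by (simp add: ctranspose_mult mult_assoc_dim mult_eqs mult_eqs_left Q(2))
  have KH: "X * (ctranspose X * (ctranspose A * (A * Z))) = X * (A * Z)" if "dim_row Z = n" for Z
    using that by (simp add: mult_eqs_left)
  have "X * (ctranspose X * Q) = X * (ctranspose X * (X * A)) * Q"
    by (simp add: adjoint_eqs mult_assoc_dim)
  also have "\<dots> = X * (ctranspose X * (X * (A * Q)))"
    by (simp add: mult_assoc_dim)
  also have "\<dots> = X * (ctranspose X * (ctranspose A * (A * (Q * (X * ctranspose X)))))"
    unfolding QP'[symmetric] QP ..
  also have "\<dots> = X * (A * Q) * (X * ctranspose X)"
    by (simp add: KH mult_assoc_dim)
  also have "\<dots> = Q * (X * ctranspose X)"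
    unfolding QP'[symmetric] by (simp add: mult_assoc_dim mult_eqs_left)
  finally show "X * (ctranspose X * Q) = Q * (X * ctranspose X)" .
qed

text \<open>Since \<open>X = X * ctranspose X * ctranspose A\<close>, the matrix equals
  \<open>A * (Q * K) * ctranspose A\<close> with \<open>K = X * ctranspose X\<close>, and
  \<open>Q * K\<close> is Hermitian because its Hermitian factors commute.\<close>

lemma hermitian_mult_projection:
  assumes Q: "Q \<in> carrier_mat n n" "ctranspose Q = Q"
    and comm: "Q * (ctranspose A * A) = ctranspose A * (A * Q)"
  shows "ctranspose (A * (Q * X)) = A * (Q * X)"
proof -
  have [simp]: "dim_row Q = n" "dim_col Q = n" using Q by auto
  note K = commute_pseudo_inverse(2)[OF assms]
  have K': "X * (ctranspose X * (Q * Z)) = Q * (X * (ctranspose X * Z))" if "dim_row Z = n" for Z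
    using arg_cong[OF K, of "\<lambda>M. M * Z"] that by (simp add: mult_assoc_dim)
  have "A * (Q * X) = A * (Q * (X * (ctranspose X * ctranspose A)))"
    by (simp only: mult_eqs)
  also have "ctranspose \<dots> = A * (X * (ctranspose X * (Q * ctranspose A)))"
    by (simp add: ctranspose_mult Q(2) mult_assoc_dim)
  also have "\<dots> = A * (Q * (X * (ctranspose X * ctranspose A)))"
    by (simp only: K' dim_ctranspose dims)
  finally show ?thesis by (simp add: mult_eqs)
qed

end

lemma weak_mp_inverse_unique:
  assumes "weak_mp_inverse A X" "weak_mp_inverse A Y"
  shows "X = Y"
proof -
  obtain m n where A: "A \<in> carrier_mat m n" by blast
  interpret X: weak_mp_pair A X m n by (intro weak_mp_pair.intro A assms)
  interpret Y: weak_mp_pair A Y m n by (intro weak_mp_pair.intro A assms)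
  have L: "A * (Y * (A * X)) = A * X"
    if "weak_mp_pair A X m n" "weak_mp_pair A Y m n" for X Y
  proof -
    interpret X: weak_mp_pair A X m n by fact
    interpret Y: weak_mp_pair A Y m n by fact
    have "A * (Y * (A * X)) = A * (Y * (A * (ctranspose A * (ctranspose X * X))))"
      by (simp add: X.mult_eqs X.mult_eqs_left)
    also have "\<dots> = A * X"
      by (simp only: Y.mult_eqs_left X.dims dim_ctranspose index_mult_mat)
        (simp add: X.mult_eqs X.mult_eqs_left)
    finally show ?thesis .
  qed
  have R: "X * (A * (Y * A)) = X * A"
    if "weak_mp_pair A X m n" "weak_mp_pair A Y m n" for X Y
  proof -
    interpret X: weak_mp_pair A X m n by fact
    interpret Y: weak_mp_pair A Y m n by fact
    have "X * (A * (Y * A)) = X * (ctranspose X * (ctranspose A * (A * (Y * A))))"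
      by (simp add: X.mult_eqs X.mult_eqs_left)
    also have "\<dots> = X * A"
      unfolding Y.mult_eqs by (simp add: X.mult_eqs X.mult_eqs_left)
    finally show ?thesis .
  qed
  note XY = X.weak_mp_pair_axioms Y.weak_mp_pair_axioms
  have AXY: "A * X = A * Y"
    using L[OF XY] arg_cong[OF L[OF XY(2,1)], of ctranspose]
    by (simp add: ctranspose_mult mult_assoc_dim X.mult_eqs X.mult_eqs_left Y.mult_eqs Y.mult_eqs_left)
  have XAY: "X * A = Y * A"
    using R[OF XY] arg_cong[OF R[OF XY(2,1)], of ctranspose]
    by (simp add: ctranspose_mult mult_assoc_dim X.mult_eqs X.mult_eqs_left Y.mult_eqs Y.mult_eqs_left)
  have "X = X * A * X" by (simp add: mult_assoc_dim X.mult_eqs)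
  also have "\<dots> = Y * (A * Y)" unfolding XAY by (simp add: mult_assoc_dim AXY)
  finally show ?thesis by (simp add: Y.mult_eqs)
qed

text \<open>Taking adjoints exchanges the two weakened equations. Facts about
  \<open>ctranspose A * A\<close> thereby become facts about
  \<open>A * ctranspose A\<close>.\<close>

lemma weak_mp_inverse_ctranspose:
  assumes "weak_mp_inverse A X"
  shows "weak_mp_inverse (ctranspose A) (ctranspose X)"
proof -
  obtain m n where A: "A \<in> carrier_mat m n" by blast
  interpret weak_mp_pair A X m n by (intro weak_mp_pair.intro A assms)
  show ?thesis
    unfolding weak_mp_inverse_def
    by (simp add: carrier_mat_iff ctranspose_mult mult_assoc_dim mult_eqs mult_eqs_left adjoint_eqs)
qed

text \<open>With the projections \<open>P = X * A\<close> and \<open>Q = B * Y\<close>, the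
  hypotheses amount to \<open>P\<close> commuting with \<open>B * ctranspose B\<close> and
  \<open>Q\<close> commuting with \<open>ctranspose A * A\<close>. Then \<open>P\<close> and
  \<open>Q\<close> commute, and the equations for the product follow.\<close>

lemma weak_mp_inverse_mult:
  fixes A B :: "'a::{conjugatable_ring, comm_ring_1} mat"
  assumes AB: "A \<in> carrier_mat m q" "B \<in> carrier_mat q n"
    and mpA: "weak_mp_inverse A X" and mpB: "weak_mp_inverse B Y"
    and 1: "X * A * B * ctranspose B * ctranspose A = B * ctranspose B * ctranspose A"
    and 2: "B * Y * ctranspose A * A * B = ctranspose A * A * B"
  shows "weak_mp_inverse (A * B) (Y * X)"
proof -
  interpret A: weak_mp_pair A X m q by (intro weak_mp_pair.intro AB mpA)
  interpret B: weak_mp_pair B Y q n by (intro weak_mp_pair.intro AB mpB)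
  interpret B': weak_mp_pair "ctranspose B" "ctranspose Y" n q
    by (intro weak_mp_pair.intro weak_mp_inverse_ctranspose mpB) (simp add: AB)
  note s = ctranspose_mult mult_assoc_dim A.mult_eqs A.mult_eqs_left B.mult_eqs B.mult_eqs_left
  have 1: "X * (A * (B * (ctranspose B * ctranspose A))) = B * (ctranspose B * ctranspose A)"
    using 1 by (simp add: mult_assoc_dim)
  have 2: "B * (Y * (ctranspose A * (A * B))) = ctranspose A * (A * B)"
    using 2 by (simp add: mult_assoc_dim)
  \<comment> \<open>The factor \<open>ctranspose X\<close> completes \<open>ctranspose A\<close> to
    \<open>P\<close>. The left side is then \<open>P * B * ctranspose B * P\<close>, which is
    Hermitian, hence so is the right side.\<close>
  have 3: "X * (A * (B * (ctranspose B * (X * A)))) = B * (ctranspose B * (X * A))"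
    using arg_cong[OF 1, of "\<lambda>M. M * ctranspose X"] by (simp add: s)
  have "ctranspose (X * (A * (B * (ctranspose B * (X * A))))) = X * (A * (B * (ctranspose B * (X * A))))"
    by (simp add: s)
  then have P: "X * A * (B * ctranspose B) = B * (ctranspose B * (X * A))"
    unfolding 3 by (simp add: s)
  have 4: "B * (Y * (ctranspose A * (A * (B * Y)))) = ctranspose A * (A * (B * Y))"
    using arg_cong[OF 2, of "\<lambda>M. M * Y"] by (simp add: s)
  have "ctranspose (B * (Y * (ctranspose A * (A * (B * Y))))) = B * (Y * (ctranspose A * (A * (B * Y))))"
    by (simp add: s)
  then have Q: "B * Y * (ctranspose A * A) = ctranspose A * (A * (B * Y))"
    unfolding 4 by (simp add: s)
  have cQ: "B * Y \<in> carrier_mat q q" "ctranspose (B * Y) = B * Y"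
    and cP: "X * A \<in> carrier_mat q q" "ctranspose (X * A) = X * A"
    by (simp_all add: carrier_mat_iff s)
  have QP: "B * (Y * (X * A)) = X * (A * (B * Y))"
    using A.commute_pseudo_inverse(1)[OF cQ Q] by (simp add: s)
  have h1: "ctranspose (A * (B * (Y * X))) = A * (B * (Y * X))"
    using A.hermitian_mult_projection[OF cQ Q] by (simp add: mult_assoc_dim)
  \<comment> \<open>For \<open>ctranspose B\<close> and its inverse \<open>ctranspose Y\<close> the
    Gram matrix is \<open>B * ctranspose B\<close>, with which \<open>P\<close> commutes. The
    adjoint of the matrix obtained is \<open>Y * P * B\<close>.\<close>
  have "ctranspose (ctranspose B * (X * A * ctranspose Y)) = ctranspose B * (X * A * ctranspose Y)"
    by (rule B'.hermitian_mult_projection[OF cP]) (use P in simp)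
  then have h2: "ctranspose (Y * (X * (A * B))) = Y * (X * (A * B))"
    by (simp add: s)
  have r: "Y * (X * (A * (B * (Y * X)))) = Y * X"
  proof -
    have "Y * (X * (A * (B * (Y * X)))) = Y * (X * (A * (B * Y))) * X" by (simp add: mult_assoc_dim)
    also have "\<dots> = Y * X" unfolding QP[symmetric] by (simp add: s)
    finally show ?thesis .
  qed
  \<comment> \<open>Exchange \<open>Q\<close> and \<open>P\<close>, absorb \<open>P\<close> into
    \<open>ctranspose A * A\<close>, move \<open>Q\<close> to the left of
    \<open>ctranspose A * A\<close>, and apply the second hypothesis.\<close>
  have l: "ctranspose B * (ctranspose A * (A * (B * (Y * (X * (A * B)))))) =
    ctranspose B * (ctranspose A * (A * B))"
  proof -
    have "ctranspose B * (ctranspose A * (A * (B * (Y * (X * (A * B)))))) =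
      ctranspose B * (ctranspose A * (A * (B * (Y * (X * A))))) * B"
      by (simp add: mult_assoc_dim)
    also have "\<dots> = ctranspose B * (ctranspose A * (A * (B * Y))) * B"
      unfolding QP by (simp add: s)
    also have "\<dots> = ctranspose B * (B * (Y * (ctranspose A * (A * B))))"
      unfolding Q[symmetric] by (simp add: mult_assoc_dim)
    finally show ?thesis unfolding 2 .
  qed
  have r2: "A * (B * (Y * (X * (A * (B * (ctranspose B * ctranspose A)))))) =
    A * (B * (ctranspose B * ctranspose A))"
    unfolding 1 by (simp add: s)
  show ?thesis
    unfolding weak_mp_inverse_def
    using h1 h2 r l r2 by (simp add: carrier_mat_iff mult_assoc_dim ctranspose_mult)
qed

section \<open>Unitary equivalence and the complex singular value decomposition\<close>

text \<open>Stated over any commutative ring with conjugation because it serves complex and dual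
  complex matrices alike.\<close>

definition unitary_of_dim :: "nat \<Rightarrow> 'a::{conjugatable_ring, comm_ring_1} mat \<Rightarrow> bool" where
  "unitary_of_dim n U \<longleftrightarrow>
    U \<in> carrier_mat n n \<and> ctranspose U * U = 1\<^sub>m n \<and> U * ctranspose U = 1\<^sub>m n"

lemma unitary_of_dimD:
  assumes "unitary_of_dim n U"
  shows "U \<in> carrier_mat n n" "dim_row U = n" "dim_col U = n"
    "ctranspose U * U = 1\<^sub>m n" "U * ctranspose U = 1\<^sub>m n"
    "\<And>Z. dim_row Z = n \<Longrightarrow> ctranspose U * (U * Z) = Z"
    "\<And>Z. dim_row Z = n \<Longrightarrow> U * (ctranspose U * Z) = Z"
proof -
  show *: "U \<in> carrier_mat n n" "dim_row U = n" "dim_col U = n"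
    "ctranspose U * U = 1\<^sub>m n" "U * ctranspose U = 1\<^sub>m n"
    using assms by (auto simp: unitary_of_dim_def)
  show "ctranspose U * (U * Z) = Z" if "dim_row Z = n" for Z
    using arg_cong[OF *(4), of "\<lambda>M. M * Z"] that *(2,3)
    by (simp add: mult_assoc_dim)
  show "U * (ctranspose U * Z) = Z" if "dim_row Z = n" for Z
    using arg_cong[OF *(5), of "\<lambda>M. M * Z"] that *(2,3)
    by (simp add: mult_assoc_dim)
qed

lemma unitary_of_dim_one: "unitary_of_dim n (1\<^sub>m n)"
  by (simp add: unitary_of_dim_def)

lemma unitary_of_dim_ctranspose: "unitary_of_dim n U \<Longrightarrow> unitary_of_dim n (ctranspose U)"
  by (simp add: unitary_of_dim_def)

lemma unitary_of_dim_mult: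
  assumes "unitary_of_dim n U" "unitary_of_dim n V"
  shows "unitary_of_dim n (U * V)"
  using unitary_of_dimD[OF assms(1)] unitary_of_dimD[OF assms(2)]
  by (simp add: unitary_of_dim_def ctranspose_mult mult_assoc_dim)

definition block_diag :: "'a::zero mat \<Rightarrow> 'a mat \<Rightarrow> 'a mat" where
  "block_diag A B =
    four_block_mat A (0\<^sub>m (dim_row A) (dim_col B)) (0\<^sub>m (dim_row B) (dim_col A)) B"

lemma dim_block_diag [simp]:
  "dim_row (block_diag A B) = dim_row A + dim_row B"
  "dim_col (block_diag A B) = dim_col A + dim_col B"
  by (simp_all add: block_diag_def)

lemma index_block_diag:
  "i < dim_row A + dim_row B \<Longrightarrow> j < dim_col A + dim_col B \<Longrightarrow>
    block_diag A B $$ (i, j) =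
      (if i < dim_row A \<and> j < dim_col A then A $$ (i, j)
       else if dim_row A \<le> i \<and> dim_col A \<le> j then B $$ (i - dim_row A, j - dim_col A) else 0)"
  by (auto simp: block_diag_def)

lemma block_diag_mult:
  fixes A B C D :: "'a::semiring_0 mat"
  assumes "dim_col A = dim_row C" "dim_col B = dim_row D"
  shows "block_diag A B * block_diag C D = block_diag (A * C) (B * D)"
proof -
  have "A \<in> carrier_mat (dim_row A) (dim_row C)" "B \<in> carrier_mat (dim_row B) (dim_row D)"
    using assms by (auto simp only: carrier_mat_iff)
  note c = this carrier_matI[OF refl refl, of C] carrier_matI[OF refl refl, of D]
  show ?thesis
    unfolding block_diag_def assms
    by (subst mult_four_block_mat[OF c(1) zero_carrier_mat zero_carrier_mat c(2,3)
          zero_carrier_mat zero_carrier_mat c(4)])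
      (simp add: assms, intro cong_four_block_mat refl right_add_zero_mat left_add_zero_mat carrier_matI,
        simp_all)
qed

lemma block_diag_ctranspose:
  fixes A B :: "'a::conjugatable_ring mat"
  shows "ctranspose (block_diag A B) = block_diag (ctranspose A) (ctranspose B)"
  unfolding block_diag_def by (subst ctranspose_four_block) auto

lemma block_diag_one: "block_diag (1\<^sub>m a) (1\<^sub>m b) = 1\<^sub>m (a + b)"
  by (simp add: block_diag_def)

text \<open>Lets the lower block of a normal block diagonal matrix inherit normality.\<close>

lemma block_diag_inj_right:
  assumes "block_diag A B = block_diag A' B'" "dim_row A = dim_row A'" "dim_col A = dim_col A'"
  shows "B = B'"
proof (rule eq_matI)
  show d: "dim_row B = dim_row B'" "dim_col B = dim_col B'"
    using arg_cong[OF assms(1), of dim_row] arg_cong[OF assms(1), of dim_col] assms(2,3) by auto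
  fix i j assume "i < dim_row B'" "j < dim_col B'"
  then show "B $$ (i, j) = B' $$ (i, j)"
    using arg_cong[OF assms(1), of "\<lambda>M. M $$ (i + dim_row A, j + dim_col A)"] assms(2,3) d
    by (simp add: index_block_diag)
qed

lemma unitary_of_dim_block_diag:
  "unitary_of_dim a U \<Longrightarrow> unitary_of_dim b V \<Longrightarrow> unitary_of_dim (a + b) (block_diag U V)"
  unfolding unitary_of_dim_def
  by (intro conjI carrier_matI) (auto simp: block_diag_ctranspose block_diag_mult block_diag_one)

lemma block_diag_split:
  fixes A :: "'a::zero mat"
  assumes "A \<in> carrier_mat (a + m) (b + n)"
    and "\<And>i j. i < a \<Longrightarrow> b \<le> j \<Longrightarrow> j < b + n \<Longrightarrow> A $$ (i, j) = 0"
    and "\<And>i j. a \<le> i \<Longrightarrow> i < a + m \<Longrightarrow> j < b \<Longrightarrow> A $$ (i, j) = 0"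
  shows "A = block_diag (mat a b (\<lambda>(i, j). A $$ (i, j))) (mat m n (\<lambda>(i, j). A $$ (i + a, j + b)))"
proof -
  have d: "dim_row A = a + m" "dim_col A = b + n" using assms(1) by auto
  show ?thesis
  proof (rule eq_matI)
    fix i j
    assume "i < dim_row (block_diag (mat a b (\<lambda>(i, j). A $$ (i, j))) (mat m n (\<lambda>(i, j). A $$ (i + a, j + b))))"
      "j < dim_col (block_diag (mat a b (\<lambda>(i, j). A $$ (i, j))) (mat m n (\<lambda>(i, j). A $$ (i + a, j + b))))"
    then show "A $$ (i, j) = block_diag (mat a b (\<lambda>(i, j). A $$ (i, j)))
        (mat m n (\<lambda>(i, j). A $$ (i + a, j + b))) $$ (i, j)"
      using assms(2)[of i j] assms(3)[of i j] by (auto simp: index_block_diag not_less)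
  qed (simp_all add: d)
qed

definition unitarily_equivalent ::
  "nat \<Rightarrow> nat \<Rightarrow> 'a::{conjugatable_ring, comm_ring_1} mat \<Rightarrow> 'a mat \<Rightarrow> bool" where
  "unitarily_equivalent m n A B \<longleftrightarrow> A \<in> carrier_mat m n \<and>
    (\<exists>U V. unitary_of_dim m U \<and> unitary_of_dim n V \<and> B = U * (A * V))"

lemma unitarily_equivalentI:
  assumes "A \<in> carrier_mat m n" "unitary_of_dim m U" "unitary_of_dim n V" "B = U * (A * V)"
  shows "unitarily_equivalent m n A B"
  using assms unfolding unitarily_equivalent_def by blast

lemma unitarily_equivalent_refl:
  "A \<in> carrier_mat m n \<Longrightarrow> unitarily_equivalent m n A A"
  by (rule unitarily_equivalentI[OF _ unitary_of_dim_one unitary_of_dim_one]) simp_all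

lemma unitarily_equivalent_trans [trans]:
  assumes "unitarily_equivalent m n A B" "unitarily_equivalent m n B C"
  shows "unitarily_equivalent m n A C"
proof -
  obtain U V where 1: "unitary_of_dim m U" "unitary_of_dim n V" "B = U * (A * V)" "A \<in> carrier_mat m n"
    using assms(1) unfolding unitarily_equivalent_def by blast
  obtain U' V' where 2: "unitary_of_dim m U'" "unitary_of_dim n V'" "C = U' * (B * V')"
    using assms(2) unfolding unitarily_equivalent_def by blast
  have d: "dim_row A = m" "dim_col A = n" using 1 by auto
  note dims = unitary_of_dimD(2,3)[OF 1(1)] unitary_of_dimD(2,3)[OF 1(2)]
    unitary_of_dimD(2,3)[OF 2(1)] unitary_of_dimD(2,3)[OF 2(2)]
  show ?thesis
    by (rule unitarily_equivalentI[OF 1(4) unitary_of_dim_mult[OF 2(1) 1(1)] unitary_of_dim_mult[OF 1(2) 2(2)]])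
      (simp add: 1(3) 2(3) mult_assoc_dim dims d)
qed

lemma unitarily_equivalent_block_diag:
  assumes "unitarily_equivalent m n A A'" "unitarily_equivalent p q B B'"
  shows "unitarily_equivalent (m + p) (n + q) (block_diag A B) (block_diag A' B')"
proof -
  obtain U V where 1: "unitary_of_dim m U" "unitary_of_dim n V" "A' = U * (A * V)" "A \<in> carrier_mat m n"
    using assms(1) unfolding unitarily_equivalent_def by blast
  obtain U' V' where 2: "unitary_of_dim p U'" "unitary_of_dim q V'" "B' = U' * (B * V')" "B \<in> carrier_mat p q"
    using assms(2) unfolding unitarily_equivalent_def by blast
  have d: "dim_row A = m" "dim_col A = n" "dim_row B = p" "dim_col B = q" using 1 2 by auto
  note dims = unitary_of_dimD(2,3)[OF 1(1)] unitary_of_dimD(2,3)[OF 1(2)]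
    unitary_of_dimD(2,3)[OF 2(1)] unitary_of_dimD(2,3)[OF 2(2)]
  show ?thesis
    by (rule unitarily_equivalentI[OF _ unitary_of_dim_block_diag[OF 1(1) 2(1)]
        unitary_of_dim_block_diag[OF 1(2) 2(2)]])
      (rule carrier_matI, simp_all add: 1(3) 2(3) block_diag_mult dims d)
qed

section \<open>Spectral theorem for complex normal matrices\<close>

text \<open>Gram-Schmidt, applied to a basis that begins with \<open>v\<close>, keeps
  \<open>v\<close> in first place; dividing each vector by its norm makes the columns
  orthonormal.\<close>

lemma unitary_completion:
  fixes v :: "complex vec"
  assumes v: "v \<in> carrier_vec n" "v \<noteq> 0\<^sub>v n"
  obtains U c where "unitary_of_dim n U" "c > 0" "col U 0 = complex_of_real c \<cdot>\<^sub>v v"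
proof -
  have n: "n \<noteq> 0"
  proof
    assume "n = 0"
    then have "v = 0\<^sub>v n" using v(1) by (intro eq_vecI) auto
    with v(2) show False by simp
  qed
  interpret cof_vec_space n "TYPE(complex)" .
  define b where "b = basis_completion v"
  define ws where "ws = gram_schmidt n b"
  from basis_completion[OF v, folded b_def]
  have b: "distinct b" "\<not> lin_dep (set b)" "set b \<subseteq> carrier_vec n" "hd b = v" "length b = n"
    by auto
  from b n obtain vs where bv: "b = v # vs" by (cases b, auto)
  from gram_schmidt_result[OF b(3,1,2) refl, folded ws_def]
  have ws: "set ws \<subseteq> carrier_vec n" "corthogonal ws" "length ws = n" by (auto simp: b)
  from gram_schmidt_hd[OF v(1), of vs, folded bv] have "hd ws = v" unfolding ws_def .
  then have w0: "ws ! 0 = v" using ws(3) n by (cases ws) auto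
  define nrm where "nrm j = sqrt (Re (ws ! j \<bullet>c ws ! j))" for j
  have wi: "ws ! i \<in> carrier_vec n" if "i < n" for i using ws that by auto
  have sq: "ws ! i \<bullet>c ws ! i = complex_of_real (nrm i ^ 2)" "nrm i > 0" if "i < n" for i
  proof -
    have "ws ! i \<bullet>c ws ! i \<ge> 0" by (rule conjugate_square_ge_0_vec)
    moreover have "ws ! i \<bullet>c ws ! i \<noteq> 0" using corthogonalD[OF ws(2), of i i] that ws(3) by auto
    ultimately have "Im (ws ! i \<bullet>c ws ! i) = 0" "Re (ws ! i \<bullet>c ws ! i) > 0"
      by (auto simp: less_eq_complex_def complex_eq_iff)
    then show "ws ! i \<bullet>c ws ! i = complex_of_real (nrm i ^ 2)" "nrm i > 0"
      by (auto simp: nrm_def complex_eq_iff)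
  qed
  define U where "U = mat n n (\<lambda>(i, j). (ws ! j) $ i / complex_of_real (nrm j))"
  have U: "U \<in> carrier_mat n n" by (simp add: U_def)
  have UU: "ctranspose U * U = 1\<^sub>m n"
  proof (rule eq_matI)
    fix i j assume "i < dim_row (1\<^sub>m n :: complex mat)" "j < dim_col (1\<^sub>m n :: complex mat)"
    then have ij: "i < n" "j < n" by auto
    have "(ctranspose U * U) $$ (i, j) =
      (\<Sum>k<n. (ws ! j) $ k * cnj ((ws ! i) $ k) / (nrm j * nrm i))"
      using ij by (simp add: U_def scalar_prod_def lessThan_atLeast0 mult.commute)
    also have "\<dots> = (ws ! j \<bullet>c ws ! i) / (nrm j * nrm i)"
      using wi[OF ij(1)] wi[OF ij(2)]
      by (simp add: scalar_prod_def lessThan_atLeast0 sum_divide_distrib)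
    also have "\<dots> = 1\<^sub>m n $$ (i, j)"
    proof (cases "i = j")
      case True
      then show ?thesis using sq[OF ij(1)] ij by (simp add: power2_eq_square)
    next
      case False
      then show ?thesis using corthogonalD[OF ws(2), of j i] ij ws(3) by simp
    qed
    finally show "(ctranspose U * U) $$ (i, j) = 1\<^sub>m n $$ (i, j)" .
  qed (simp_all add: U_def)
  have "U * ctranspose U = 1\<^sub>m n"
    by (rule mat_mult_left_right_inverse[OF _ U UU]) (simp add: U)
  with U UU have "unitary_of_dim n U" by (simp add: unitary_of_dim_def)
  moreover have "col U 0 = complex_of_real (1 / nrm 0) \<cdot>\<^sub>v v"
    by (rule eq_vecI) (use n v w0 in \<open>auto simp: U_def\<close>)
  ultimately show ?thesis using sq(2)[of 0] n by (intro that[of U "1 / nrm 0"]) auto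
qed

text \<open>The deflation step: with \<open>U = V\<close> it splits off an eigenvalue, and applied
  to both \<open>A\<close> and its adjoint it splits off a singular value.\<close>

lemma first_col_transform:
  fixes A :: "complex mat"
  assumes A: "A \<in> carrier_mat m n" and U: "unitary_of_dim m U" and V: "unitary_of_dim n V"
    and eq: "A *\<^sub>v col V 0 = k \<cdot>\<^sub>v col U 0" and i: "i < m" and n: "0 < n"
  shows "(ctranspose U * (A * V)) $$ (i, 0) = (if i = 0 then k else 0)"
proof -
  have cU: "U \<in> carrier_mat m m" "ctranspose U \<in> carrier_mat m m" and cV: "V \<in> carrier_mat n n"
    using unitary_of_dimD(1)[OF U] unitary_of_dimD(1)[OF V] by auto
  have c0: "col U 0 \<in> carrier_vec m" using cU by auto
  have "col (ctranspose U * (A * V)) 0 = ctranspose U *\<^sub>v col (A * V) 0"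
    by (rule col_mult2[OF cU(2) _ n]) (use A cV in auto)
  also have "col (A * V) 0 = k \<cdot>\<^sub>v col U 0"
    unfolding eq[symmetric] by (rule col_mult2[OF A cV n])
  also have "ctranspose U *\<^sub>v (k \<cdot>\<^sub>v col U 0) = k \<cdot>\<^sub>v (ctranspose U *\<^sub>v col U 0)"
    by (rule mult_mat_vec[OF cU(2) c0])
  also have "ctranspose U *\<^sub>v col U 0 = col (ctranspose U * U) 0"
    by (rule col_mult2[OF cU(2,1), symmetric]) (use i in simp)
  finally have "col (ctranspose U * (A * V)) 0 = k \<cdot>\<^sub>v col (1\<^sub>m m) 0"
    using unitary_of_dimD(4)[OF U] by simp
  from arg_cong[OF this, of "\<lambda>w. w $ i"] show ?thesis
    using i n A cU cV by (auto split: if_splits)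
qed

lemma mult_ctranspose_diag_entry:
  fixes A :: "complex mat"
  assumes "i < dim_row A"
  shows "(A * ctranspose A) $$ (i, i) = of_real (\<Sum>j<dim_col A. cmod (A $$ (i, j)) ^ 2)"
  using assms
  by (simp add: scalar_prod_def lessThan_atLeast0 complex_norm_square del: of_real_power)

theorem normal_unitarily_diagonalizable:
  fixes A :: "complex mat"
  assumes "A \<in> carrier_mat n n" "A * ctranspose A = ctranspose A * A"
  shows "\<exists>U. unitary_of_dim n U \<and> diagonal_mat (ctranspose U * (A * U))"
  using assms
proof (induction n arbitrary: A)
  case 0
  then show ?case
    by (intro exI[of _ "1\<^sub>m 0"]) (auto simp: unitary_of_dim_one diagonal_mat_def)
next
  case (Suc n)
  obtain e where "e \<in> spectrum A" using spectrum_non_empty[OF Suc.prems(1)] by blast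
  then obtain v where v: "v \<in> carrier_vec (Suc n)" "v \<noteq> 0\<^sub>v (Suc n)" "A *\<^sub>v v = e \<cdot>\<^sub>v v"
    using Suc.prems(1) by (auto simp: spectrum_def eigenvalue_def eigenvector_def)
  obtain U c where U: "unitary_of_dim (Suc n) U" and c: "col U 0 = complex_of_real c \<cdot>\<^sub>v v"
    using unitary_completion[OF v(1,2)] by metis
  define B where "B = ctranspose U * (A * U)"
  note Ud = unitary_of_dimD[OF U]
  have dA [simp]: "dim_row A = Suc n" "dim_col A = Suc n" using Suc.prems(1) by auto
  have B: "B \<in> carrier_mat (1 + n) (1 + n)" using Ud by (intro carrier_matI) (simp_all add: B_def)
  have AU: "A *\<^sub>v col U 0 = e \<cdot>\<^sub>v col U 0"
    unfolding c mult_mat_vec[OF Suc.prems(1) v(1)] v(3)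
    by (simp add: smult_smult_assoc mult.commute)
  have col: "B $$ (i, 0) = (if i = 0 then e else 0)" if "i < Suc n" for i
    unfolding B_def by (rule first_col_transform[OF Suc.prems(1) U U AU that]) simp
  have norm: "B * ctranspose B = ctranspose B * B"
  proof -
    have "B * ctranspose B = ctranspose U * ((A * ctranspose A) * U)"
      by (simp add: B_def ctranspose_mult mult_assoc_dim Ud)
    also have "\<dots> = ctranspose B * B"
      unfolding Suc.prems(2) by (simp add: B_def ctranspose_mult mult_assoc_dim Ud)
    finally show ?thesis .
  qed
  have dB: "dim_row B = Suc n" "dim_col B = Suc n" using B by auto
  \<comment> \<open>Normality equates the squared norms of the first row and the first column of
    \<open>B\<close>. The column consists of \<open>e\<close> alone and the row also starts with
    \<open>e\<close>, so the rest of the row vanishes.\<close>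
  have "complex_of_real (\<Sum>j<Suc n. cmod (B $$ (0, j)) ^ 2) = (B * ctranspose B) $$ (0, 0)"
    using dB by (subst mult_ctranspose_diag_entry) auto
  also have "\<dots> = (ctranspose B * ctranspose (ctranspose B)) $$ (0, 0)"
    unfolding norm by simp
  also have "\<dots> = complex_of_real (\<Sum>j<Suc n. cmod (ctranspose B $$ (0, j)) ^ 2)"
    using dB by (subst mult_ctranspose_diag_entry) auto
  also have "(\<Sum>j<Suc n. cmod (ctranspose B $$ (0, j)) ^ 2) = cmod e ^ 2"
    unfolding sum.lessThan_Suc_shift using dB col by simp
  finally have "(\<Sum>j<n. cmod (B $$ (0, Suc j)) ^ 2) = 0"
    unfolding of_real_eq_iff sum.lessThan_Suc_shift using col[of 0] by simp
  then have row: "B $$ (0, Suc j) = 0" if "j < n" for j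
    using that by (subst (asm) sum_nonneg_eq_0_iff) auto
  define B1 B2 where "B1 = mat 1 1 (\<lambda>(i, j). B $$ (i, j))"
    and "B2 = mat n n (\<lambda>(i, j). B $$ (i + 1, j + 1))"
  have Bb: "B = block_diag B1 B2"
    unfolding B1_def B2_def
  proof (rule block_diag_split[OF B])
    show "B $$ (i, j) = 0" if "i < 1" "1 \<le> j" "j < 1 + n" for i j
      using row[of "j - 1"] that by simp
    show "B $$ (i, j) = 0" if "1 \<le> i" "i < 1 + n" "j < 1" for i j
      using col[of i] that by simp
  qed
  have B2: "B2 \<in> carrier_mat n n" by (simp add: B2_def)
  have d12 [simp]: "dim_row B1 = 1" "dim_col B1 = 1" "dim_row B2 = n" "dim_col B2 = n"
    by (simp_all add: B1_def B2_def)
  have "B2 * ctranspose B2 = ctranspose B2 * B2"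
    by (rule block_diag_inj_right[of "B1 * ctranspose B1" _ "ctranspose B1 * B1"])
      (use norm in \<open>simp_all add: block_diag_ctranspose block_diag_mult Bb\<close>)
  from Suc.IH[OF B2 this] obtain W where W: "unitary_of_dim n W"
    and dW: "diagonal_mat (ctranspose W * (B2 * W))" by blast
  note Wd = unitary_of_dimD[OF W]
  define V where "V = block_diag (1\<^sub>m 1) W"
  have V: "unitary_of_dim (Suc n) V"
    unfolding V_def using unitary_of_dim_block_diag[OF unitary_of_dim_one[of 1] W] by simp
  have "ctranspose (U * V) * (A * (U * V)) = ctranspose V * (B * V)"
    using Ud unitary_of_dimD[OF V] by (simp add: B_def ctranspose_mult mult_assoc_dim)
  also have "\<dots> = block_diag B1 (ctranspose W * (B2 * W))"
    using Wd by (simp add: Bb V_def block_diag_ctranspose block_diag_mult)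
  finally have "diagonal_mat (ctranspose (U * V) * (A * (U * V)))"
    using dW Wd unfolding diagonal_mat_def by (auto simp: index_block_diag)
  then show ?case using unitary_of_dim_mult[OF U V] by blast
qed

section \<open>Singular value decomposition of complex matrices\<close>

text \<open>The diagonal is a function on all naturals, so the same \<open>d\<close> can be used
  with matrices of different shapes.\<close>

definition rect_diag :: "nat \<Rightarrow> nat \<Rightarrow> (nat \<Rightarrow> 'a::zero) \<Rightarrow> 'a mat" where
  "rect_diag m n d = mat m n (\<lambda>(i, j). if i = j then d i else 0)"

lemma rect_diag_carrier [simp]: "rect_diag m n d \<in> carrier_mat m n"
  by (simp add: rect_diag_def)

text \<open>Induction by deflation: if \<open>u\<close> is a unit eigenvector of
  \<open>ctranspose A * A\<close> with nonzero eigenvalue and \<open>w\<close> is its image under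
  \<open>A\<close>, then \<open>A\<close> and its adjoint map the lines through \<open>u\<close> and
  \<open>w\<close> to each other. Unitary matrices starting with these directions split off one
  singular value.\<close>

theorem complex_svd:
  fixes A :: "complex mat"
  assumes "A \<in> carrier_mat m n"
  shows "\<exists>s r. r \<le> m \<and> r \<le> n \<and> (\<forall>i<r. s i > 0) \<and> (\<forall>i\<ge>r. s i = 0) \<and>
    unitarily_equivalent m n A (rect_diag m n (\<lambda>i. complex_of_real (s i)))"
  using assms
proof (induction m arbitrary: n A)
  case 0
  then have "A = rect_diag 0 n (\<lambda>i. complex_of_real 0)"
    by (intro eq_matI) (auto simp: rect_diag_def)
  then show ?case using unitarily_equivalent_refl[OF 0] by (intro exI[of _ "\<lambda>_. 0"] exI[of _ 0]) auto
next
  case (Suc m)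
  show ?case
  proof (cases "A = 0\<^sub>m (Suc m) n")
    case True
    then have "A = rect_diag (Suc m) n (\<lambda>i. complex_of_real 0)"
      by (intro eq_matI) (auto simp: rect_diag_def)
    then show ?thesis using unitarily_equivalent_refl[OF Suc.prems]
      by (intro exI[of _ "\<lambda>_. 0"] exI[of _ 0]) auto
  next
    case False
    have dA [simp]: "dim_row A = Suc m" "dim_col A = n" using Suc.prems by auto
    have cA: "ctranspose A \<in> carrier_mat n (Suc m)" using Suc.prems by simp
    from False obtain i j where ij: "i < Suc m" "j < n" "A $$ (i, j) \<noteq> 0"
      by (metis dA eq_matI index_zero_mat)
    define H where "H = ctranspose A * A"
    have H: "H \<in> carrier_mat n n" by (intro carrier_matI) (simp_all add: H_def)
    have "H * ctranspose H = ctranspose H * H" by (simp add: H_def ctranspose_mult)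
    from normal_unitarily_diagonalizable[OF H this] obtain W
      where W: "unitary_of_dim n W" and dW: "diagonal_mat (ctranspose W * (H * W))" by blast
    note Wd = unitary_of_dimD[OF W]
    define L where "L = ctranspose W * (H * W)"
    have dL [simp]: "dim_row L = n" "dim_col L = n" using Wd H by (auto simp: L_def)
    have L0: "L $$ (a, b) = 0" if "a < n" "b < n" "a \<noteq> b" for a b
      using dW that unfolding L_def[symmetric] diagonal_mat_def by simp
    have HW: "H * W = W * L" using Wd H by (simp add: L_def)
    \<comment> \<open>Otherwise \<open>L\<close> and hence \<open>H\<close> would vanish; but the
      diagonal of \<open>H\<close> holds the squared column norms of \<open>A\<close>, and column
      \<open>j\<close> is nonzero.\<close>
    have "\<exists>k<n. L $$ (k, k) \<noteq> 0"
    proof (rule ccontr)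
      assume no: "\<not> ?thesis"
      have "L = 0\<^sub>m n n"
      proof (rule eq_matI)
        fix a b assume "a < dim_row (0\<^sub>m n n :: complex mat)" "b < dim_col (0\<^sub>m n n :: complex mat)"
        then show "L $$ (a, b) = 0\<^sub>m n n $$ (a, b)"
          using no L0[of a b] by (cases "a = b") auto
      qed simp_all
      have "H = (H * W) * ctranspose W" using Wd H by (simp add: mult_assoc_dim)
      also have "\<dots> = 0\<^sub>m n n" unfolding HW \<open>L = 0\<^sub>m n n\<close> using Wd by simp
      finally have "H $$ (j, j) = 0" using ij by simp
      moreover have "H $$ (j, j) = of_real (\<Sum>k<Suc m. cmod (ctranspose A $$ (j, k)) ^ 2)"
        using mult_ctranspose_diag_entry[of j "ctranspose A"] ij by (simp add: H_def)
      ultimately have "(\<Sum>k<Suc m. cmod (ctranspose A $$ (j, k)) ^ 2) = 0"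
        by (simp only: of_real_eq_0_iff)
      then have "cmod (ctranspose A $$ (j, i)) ^ 2 = 0"
        using ij(1) by (subst (asm) sum_nonneg_eq_0_iff) auto
      with ij show False by simp
    qed
    then obtain k where k: "k < n" "L $$ (k, k) \<noteq> 0" by blast
    define l where "l = L $$ (k, k)"
    have l: "l \<noteq> 0" using k by (simp add: l_def)
    define v where "v = col W k"
    have v: "v \<in> carrier_vec n" using Wd by (auto simp: v_def)
    have Hv: "H *\<^sub>v v = l \<cdot>\<^sub>v v"
    proof -
      have "H *\<^sub>v v = col (W * L) k"
        unfolding HW[symmetric] v_def by (rule col_mult2[OF H Wd(1) k(1), symmetric])
      also have "\<dots> = W *\<^sub>v col L k"
        by (rule col_mult2[OF Wd(1) _ k(1)]) (rule carrier_matI, simp_all)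
      also have "col L k = l \<cdot>\<^sub>v unit_vec n k"
        using L0 k(1) by (intro eq_vecI) (auto simp: l_def)
      also have "W *\<^sub>v (l \<cdot>\<^sub>v unit_vec n k) = l \<cdot>\<^sub>v (W *\<^sub>v unit_vec n k)"
        by (rule mult_mat_vec[OF Wd(1)]) simp
      also have "W *\<^sub>v unit_vec n k = v"
        using Wd k(1) by (intro eq_vecI) (auto simp: v_def)
      finally show ?thesis .
    qed
    have v0: "v \<noteq> 0\<^sub>v n"
    proof
      assume "v = 0\<^sub>v n"
      then have "ctranspose W *\<^sub>v col W k = 0\<^sub>v n" using Wd by (auto simp: v_def)
      then have "col (ctranspose W * W) k = 0\<^sub>v n"
        using col_mult2[OF _ Wd(1) k(1), of "ctranspose W" n] Wd by simp
      from arg_cong[OF this, of "\<lambda>w. w $ k"] show False using Wd k(1) by simp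
    qed
    obtain V c where V: "unitary_of_dim n V" "c > 0" "col V 0 = complex_of_real c \<cdot>\<^sub>v v"
      using unitary_completion[OF v v0] by metis
    define u where "u = col V 0"
    have u: "u \<in> carrier_vec n" using V v by (simp add: u_def)
    define w where "w = A *\<^sub>v u"
    have w: "w \<in> carrier_vec (Suc m)" using Suc.prems u by (simp add: w_def)
    have Aw: "ctranspose A *\<^sub>v w = l \<cdot>\<^sub>v u"
    proof -
      have "ctranspose A *\<^sub>v w = H *\<^sub>v u"
        unfolding w_def H_def by (rule assoc_mult_mat_vec[OF cA Suc.prems u, symmetric])
      also have "\<dots> = l \<cdot>\<^sub>v u"
        unfolding u_def V(3) mult_mat_vec[OF H v] Hv by (simp add: smult_smult_assoc mult.commute)
      finally show ?thesis .
    qed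
    have w0: "w \<noteq> 0\<^sub>v (Suc m)"
    proof
      assume "w = 0\<^sub>v (Suc m)"
      moreover have "ctranspose A *\<^sub>v 0\<^sub>v (Suc m) = 0\<^sub>v n"
        by (rule eq_vecI) (auto simp: scalar_prod_def)
      ultimately have "l \<cdot>\<^sub>v u = 0\<^sub>v n" using Aw by simp
      then have "v = 0\<^sub>v n"
        using l V(2) v unfolding u_def V(3) by (auto simp: vec_eq_iff)
      with v0 show False ..
    qed
    obtain U d where U: "unitary_of_dim (Suc m) U" "d > 0" "col U 0 = complex_of_real d \<cdot>\<^sub>v w"
      using unitary_completion[OF w w0] by metis
    have "0 < n" using ij by auto
    then obtain n' where n': "n = Suc n'" by (cases n) auto
    \<comment> \<open>As \<open>col U 0\<close> is a unit vector, \<open>1 / d\<close> is the norm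
      of \<open>w\<close>; this is the singular value split off.\<close>
    have 1: "A *\<^sub>v col V 0 = complex_of_real (1 / d) \<cdot>\<^sub>v col U 0"
      unfolding U(3) using U(2) by (simp add: smult_smult_assoc w_def u_def)
    have 2: "ctranspose A *\<^sub>v col U 0 = (complex_of_real d * l) \<cdot>\<^sub>v col V 0"
      unfolding U(3) mult_mat_vec[OF cA w] Aw by (simp add: smult_smult_assoc u_def)
    define B where "B = ctranspose U * (A * V)"
    note Ud = unitary_of_dimD[OF U(1)] and Vd = unitary_of_dimD[OF V(1)]
    have B: "B \<in> carrier_mat (1 + m) (1 + n')" using Ud Vd n' by (intro carrier_matI) (simp_all add: B_def)
    have AB: "unitarily_equivalent (Suc m) n A B"
      by (rule unitarily_equivalentI[OF Suc.prems unitary_of_dim_ctranspose[OF U(1)] V(1) B_def])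
    have col: "B $$ (i, 0) = (if i = 0 then complex_of_real (1 / d) else 0)" if "i < Suc m" for i
      unfolding B_def by (rule first_col_transform[OF Suc.prems U(1) V(1) 1 that \<open>0 < n\<close>])
    have cB: "ctranspose B = ctranspose V * (ctranspose A * U)"
      using Ud Vd by (simp add: B_def ctranspose_mult mult_assoc_dim)
    \<comment> \<open>The first row of \<open>B\<close> is the conjugated first column of
      \<open>ctranspose B\<close>, to which the deflation step applies with \<open>U\<close> and
      \<open>V\<close> exchanged.\<close>
    have row: "B $$ (0, j) = 0" if "j < n" "j \<noteq> 0" for j
    proof -
      have "ctranspose B $$ (j, 0) = 0"
        unfolding cB using first_col_transform[OF cA V(1) U(1) 2 that(1)] that(2) by simp
      then show ?thesis using that B n' by simp
    qed
    define B2 where "B2 = mat m n' (\<lambda>(i, j). B $$ (i + 1, j + 1))"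
    have "B = block_diag (mat 1 1 (\<lambda>(i, j). B $$ (i, j))) B2"
      unfolding B2_def
    proof (rule block_diag_split[OF B])
      show "B $$ (i, j) = 0" if "i < 1" "1 \<le> j" "j < 1 + n'" for i j
        using row[of j] that n' by simp
      show "B $$ (i, j) = 0" if "1 \<le> i" "i < 1 + m" "j < 1" for i j
        using col[of i] that by simp
    qed
    also have "mat 1 1 (\<lambda>(i, j). B $$ (i, j)) = mat 1 1 (\<lambda>_. complex_of_real (1 / d))"
      using col[of 0] by (intro eq_matI) auto
    finally have Bb: "B = block_diag (mat 1 1 (\<lambda>_. complex_of_real (1 / d))) B2" .
    have B2: "B2 \<in> carrier_mat m n'" by (simp add: B2_def)
    from Suc.IH[OF B2] obtain s r where s: "r \<le> m" "r \<le> n'" "\<forall>i<r. s i > 0" "\<forall>i\<ge>r. s i = 0"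
      and eq: "unitarily_equivalent m n' B2 (rect_diag m n' (\<lambda>i. complex_of_real (s i)))" by blast
    define t where "t i = (case i of 0 \<Rightarrow> 1 / d | Suc i \<Rightarrow> s i)" for i
    have "unitarily_equivalent (1 + m) (1 + n') B
        (block_diag (mat 1 1 (\<lambda>_. complex_of_real (1 / d)))
          (rect_diag m n' (\<lambda>i. complex_of_real (s i))))"
      unfolding Bb by (rule unitarily_equivalent_block_diag[OF unitarily_equivalent_refl eq]) simp
    also have "block_diag (mat 1 1 (\<lambda>_. complex_of_real (1 / d)))
          (rect_diag m n' (\<lambda>i. complex_of_real (s i))) = rect_diag (1 + m) (1 + n') (\<lambda>i. complex_of_real (t i))"
      by (rule eq_matI) (auto simp: index_block_diag rect_diag_def t_def split: nat.split)
    finally have "unitarily_equivalent (Suc m) n A (rect_diag (Suc m) n (\<lambda>i. complex_of_real (t i)))"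
      using unitarily_equivalent_trans[OF AB] n' by simp
    moreover have "\<forall>i<Suc r. t i > 0" "\<forall>i\<ge>Suc r. t i = 0"
      using s(3,4) U(2) by (auto simp: t_def split: nat.split)
    ultimately show ?thesis
      using s(1,2) n' by (intro exI[of _ t] exI[of _ "Suc r"]) simp
  qed
qed

section \<open>The dual complex singular value decomposition\<close>

definition dual_mat :: "complex mat \<Rightarrow> complex mat \<Rightarrow> dual_complex mat" where
  "dual_mat X Y = mat (dim_row X) (dim_col X) (\<lambda>(i, j). Dual (X $$ (i, j)) (Y $$ (i, j)))"

lemma dim_dual_mat [simp]:
  "dim_row (dual_mat X Y) = dim_row X" "dim_col (dual_mat X Y) = dim_col X"
  by (simp_all add: dual_mat_def)

lemma index_dual_mat [simp]:
  "i < dim_row X \<Longrightarrow> j < dim_col X \<Longrightarrow> dual_mat X Y $$ (i, j) = Dual (X $$ (i, j)) (Y $$ (i, j))"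
  by (simp add: dual_mat_def)

lemma dual_mat_carrier: "X \<in> carrier_mat m n \<Longrightarrow> dual_mat X Y \<in> carrier_mat m n"
  by (simp add: dual_mat_def)

lemma dual_mat_std_inf: "dual_mat (map_mat std_part A) (map_mat inf_part A) = A"
  by (rule eq_matI) auto

lemma sum_Dual: "(\<Sum>k\<in>S. Dual (f k) (g k)) = Dual (\<Sum>k\<in>S. f k) (\<Sum>k\<in>S. g k)"
  by (induction S rule: infinite_finite_induct)
    (auto simp: zero_dual_complex_def plus_dual_complex_def)

lemma dual_mat_mult:
  assumes "X \<in> carrier_mat a b" "Y \<in> carrier_mat a b" "X' \<in> carrier_mat b c" "Y' \<in> carrier_mat b c"
  shows "dual_mat X Y * dual_mat X' Y' = dual_mat (X * X') (X * Y' + Y * X')"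
  by (rule eq_matI)
    (use assms in \<open>auto simp: scalar_prod_def times_dual_complex_def sum_Dual sum.distrib\<close>)

lemma dual_mat_ctranspose:
  assumes "X \<in> carrier_mat a b" "Y \<in> carrier_mat a b"
  shows "ctranspose (dual_mat X Y) = dual_mat (ctranspose X) (ctranspose Y)"
  by (rule eq_matI) (use assms in \<open>auto simp: conjugate_dual_complex_def\<close>)

lemma dual_mat_one: "dual_mat (1\<^sub>m n) (0\<^sub>m n n) = 1\<^sub>m n"
  by (rule eq_matI) (auto simp: one_dual_complex_def zero_dual_complex_def)

lemma unitary_dual_mat_complex:
  assumes "unitary_of_dim n U"
  shows "unitary_of_dim n (dual_mat U (0\<^sub>m n n))"
proof -
  note U = unitary_of_dimD[OF assms]
  have c: "U \<in> carrier_mat n n" "ctranspose U \<in> carrier_mat n n" "0\<^sub>m n n \<in> carrier_mat n n"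
    using U by auto
  show ?thesis
    unfolding unitary_of_dim_def
    using U c by (auto simp: dual_mat_ctranspose[of _ n n] dual_mat_mult[of _ n n] dual_mat_one
        intro: dual_mat_carrier)
qed

text \<open>The inverse of \<open>1 + P \<epsilon>\<close> is \<open>1 - P \<epsilon>\<close> since
  \<epsilon> squares to zero, and for skew-Hermitian \<open>P\<close> this is the adjoint.\<close>

lemma unitary_dual_mat_skew:
  fixes P :: "complex mat"
  assumes P: "P \<in> carrier_mat n n" "ctranspose P = - P"
  shows "unitary_of_dim n (dual_mat (1\<^sub>m n) P)"
proof -
  have d: "dim_row P = n" "dim_col P = n" using P by auto
  have c: "1\<^sub>m n \<in> carrier_mat n n" "- P \<in> carrier_mat n n" using P by auto
  have s: "P + - P = 0\<^sub>m n n" "- P + P = 0\<^sub>m n n" using d by (auto intro!: eq_matI)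
  have "dual_mat (1\<^sub>m n) (- P) * dual_mat (1\<^sub>m n) P = 1\<^sub>m n"
    unfolding dual_mat_mult[OF c c(1) P(1)] using s d by (simp add: dual_mat_one)
  moreover have "dual_mat (1\<^sub>m n) P * dual_mat (1\<^sub>m n) (- P) = 1\<^sub>m n"
    unfolding dual_mat_mult[OF c(1) P(1) c] using s d by (simp add: dual_mat_one)
  moreover have "ctranspose (dual_mat (1\<^sub>m n) P) = dual_mat (1\<^sub>m n) (- P)"
    unfolding dual_mat_ctranspose[OF c(1) P(1)] P(2) by simp
  ultimately show ?thesis
    unfolding unitary_of_dim_def by (simp add: dual_mat_carrier)
qed

lemma unitarily_equivalent_dual_mat:
  assumes X: "X \<in> carrier_mat m n" "Y \<in> carrier_mat m n"
    and U: "unitary_of_dim m U" and V: "unitary_of_dim n V"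
  shows "unitarily_equivalent m n (dual_mat X Y) (dual_mat (U * (X * V)) (U * (Y * V)))"
proof (rule unitarily_equivalentI[OF dual_mat_carrier[OF X(1)] unitary_dual_mat_complex[OF U]
      unitary_dual_mat_complex[OF V]])
  have c: "U \<in> carrier_mat m m" "V \<in> carrier_mat n n"
    using unitary_of_dimD(1)[OF U] unitary_of_dimD(1)[OF V] by auto
  have c': "X * V \<in> carrier_mat m n" "Y * V \<in> carrier_mat m n" "U * (Y * V) \<in> carrier_mat m n"
    using X c by auto
  have "dual_mat X Y * dual_mat V (0\<^sub>m n n) = dual_mat (X * V) (Y * V)"
    using X c c' by (simp add: dual_mat_mult[of _ m n _ _ n])
  then show "dual_mat (U * (X * V)) (U * (Y * V)) =
      dual_mat U (0\<^sub>m m m) * (dual_mat X Y * dual_mat V (0\<^sub>m n n))"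
    using X c c' by (simp add: dual_mat_mult[of _ m m _ _ n])
qed

text \<open>Expanding \<open>(1 + P \<epsilon>) (X + Y \<epsilon>) (1 + Q \<epsilon>)\<close> leaves
  the standard part unchanged, so the infinitesimal part can be simplified once the standard part is
  diagonal.\<close>

lemma unitarily_equivalent_infinitesimal_rotation:
  fixes X Y P Q :: "complex mat"
  assumes X: "X \<in> carrier_mat m n" "Y \<in> carrier_mat m n"
    and P: "P \<in> carrier_mat m m" "ctranspose P = - P"
    and Q: "Q \<in> carrier_mat n n" "ctranspose Q = - Q"
  shows "unitarily_equivalent m n (dual_mat X Y) (dual_mat X (X * Q + Y + P * X))"
proof (rule unitarily_equivalentI[OF dual_mat_carrier[OF X(1)] unitary_dual_mat_skew[OF P]
      unitary_dual_mat_skew[OF Q]])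
  have c: "X * Q + Y \<in> carrier_mat m n" using X Q by auto
  have "dual_mat X Y * dual_mat (1\<^sub>m n) Q = dual_mat X (X * Q + Y)"
    using X Q by (simp add: dual_mat_mult[of _ m n _ _ n])
  then show "dual_mat X (X * Q + Y + P * X) =
      dual_mat (1\<^sub>m m) P * (dual_mat X Y * dual_mat (1\<^sub>m n) Q)"
    using X c P by (simp add: dual_mat_mult[of _ m m _ _ n])
qed

section \<open>Decoupling of singular values and existence of the dual decomposition\<close>

text \<open>For \<open>n \<le> i\<close> the entry \<open>Z $$ (i, j)\<close> lies outside
  \<open>Z\<close>; the last assumption makes the product zero there, so one formula covers all
  rows.\<close>

lemma index_rect_diag_mult:
  fixes Z :: "complex mat"
  assumes "Z \<in> carrier_mat n p" "i < m" "j < p" "n \<le> i \<Longrightarrow> d i = 0"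
  shows "(rect_diag m n d * Z) $$ (i, j) = d i * Z $$ (i, j)"
proof -
  have "(rect_diag m n d * Z) $$ (i, j) = (\<Sum>k<n. (if i = k then d i else 0) * Z $$ (k, j))"
    using assms by (simp add: rect_diag_def scalar_prod_def lessThan_atLeast0)
  also have "\<dots> = (\<Sum>k<n. if i = k then d i * Z $$ (i, j) else 0)"
    by (intro sum.cong) auto
  finally show ?thesis using assms(4) by (auto simp: not_less)
qed

lemma index_mult_rect_diag:
  fixes Z :: "complex mat"
  assumes "Z \<in> carrier_mat p m" "i < p" "j < n" "m \<le> j \<Longrightarrow> d j = 0"
  shows "(Z * rect_diag m n d) $$ (i, j) = Z $$ (i, j) * d j"
proof -
  have "(Z * rect_diag m n d) $$ (i, j) = (\<Sum>k<m. Z $$ (i, k) * (if k = j then d k else 0))"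
    using assms by (simp add: rect_diag_def scalar_prod_def lessThan_atLeast0)
  also have "\<dots> = (\<Sum>k<m. if k = j then Z $$ (i, j) * d j else 0)"
    by (intro sum.cong) auto
  finally show ?thesis using assms(4) by (auto simp: not_less)
qed

text \<open>The \<open>(i, j)\<close> and \<open>(j, i)\<close> entries of \<open>X Q + Y + P X\<close> involve only \<open>P\<^sub>i\<^sub>j\<close> and \<open>Q\<^sub>i\<^sub>j\<close>. If
  \<open>s\<^sub>i \<noteq> s\<^sub>j\<close> they can be annihilated by solving a regular \<open>2 \<times> 2\<close> system; if \<open>s\<^sub>i = s\<^sub>j > 0\<close> one can
  only remove their skew-Hermitian part. The indices out of range of \<open>Y\<close> are harmless because the
  corresponding \<open>s\<close> vanishes, and so is the division by zero when \<open>s\<^sub>i = s\<^sub>j = 0\<close>.\<close>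

lemma decouple_perturbation:
  fixes Y :: "complex mat" and s :: "nat \<Rightarrow> real"
  assumes Y: "Y \<in> carrier_mat m n" and r: "r \<le> m" "r \<le> n"
    and pos: "\<And>i. i < r \<Longrightarrow> s i > 0" and zero: "\<And>i. r \<le> i \<Longrightarrow> s i = 0"
  defines "X \<equiv> rect_diag m n (\<lambda>i. complex_of_real (s i))"
  obtains Z where "Z \<in> carrier_mat m n"
    "unitarily_equivalent m n (dual_mat X Y) (dual_mat X Z)"
    "\<And>i j. i < m \<Longrightarrow> j < n \<Longrightarrow> s i \<noteq> s j \<Longrightarrow> Z $$ (i, j) = 0"
    "\<And>i j. i < r \<Longrightarrow> j < r \<Longrightarrow> Z $$ (j, i) = cnj (Z $$ (i, j))"
proof -
  \<comment> \<open>For \<open>s i \<noteq> s j\<close> the values solve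
    \<open>s j * p + s i * q = - Y $$ (i, j)\<close>, which annihilates entry \<open>(i, j)\<close>,
    and \<open>s i * p + s j * q = cnj (Y $$ (j, i))\<close>, the conjugated condition for entry
    \<open>(j, i)\<close> under skew-Hermitian symmetry. For equal positive values \<open>p\<close>
    leaves the Hermitian part of \<open>Y\<close>.\<close>
  define p where "p i j = (if s i = s j then (cnj (Y $$ (j, i)) - Y $$ (i, j)) / (2 * s i)
      else (s i * cnj (Y $$ (j, i)) + s j * Y $$ (i, j)) / (s i ^ 2 - s j ^ 2))" for i j
  define q where "q i j = (if s i = s j then 0
      else (s j * cnj (Y $$ (j, i)) + s i * Y $$ (i, j)) / (s j ^ 2 - s i ^ 2))" for i j
  define P Q where "P = mat m m (\<lambda>(i, j). p i j)" and "Q = mat n n (\<lambda>(i, j). q i j)"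
  have minus: "x / (a - b) = - (x / (b - a))" for x a b :: complex
    by (metis minus_diff_eq minus_divide_right)
  have "cnj (p j i) = - p i j" for i j
    unfolding p_def by (simp add: minus[of _ "(complex_of_real (s j))\<^sup>2"] diff_divide_distrib add.commute)
  then have P: "P \<in> carrier_mat m m" "ctranspose P = - P"
    by (auto simp: P_def intro!: eq_matI)
  have "cnj (q j i) = - q i j" for i j
    unfolding q_def by (simp add: minus[of _ "(complex_of_real (s i))\<^sup>2"] add.commute)
  then have Q: "Q \<in> carrier_mat n n" "ctranspose Q = - Q"
    by (auto simp: Q_def intro!: eq_matI)
  have X: "X \<in> carrier_mat m n" by (simp add: X_def)
  define Z where "Z = X * Q + Y + P * X"
  have Z: "Z $$ (i, j) = s i * q i j + Y $$ (i, j) + p i j * s j" if "i < m" "j < n" for i j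
  proof -
    have "(X * Q) $$ (i, j) = s i * q i j"
      unfolding X_def using index_rect_diag_mult[OF Q(1) that, of "\<lambda>i. complex_of_real (s i)"] zero[of i] r that
      by (cases "i < n") (auto simp: Q_def)
    moreover have "(P * X) $$ (i, j) = p i j * s j"
      unfolding X_def using index_mult_rect_diag[OF P(1) that, of "\<lambda>i. complex_of_real (s i)"] zero[of j] r that
      by (cases "j < m") (auto simp: P_def)
    ultimately show ?thesis using that X Y P Q by (simp add: Z_def)
  qed
  \<comment> \<open>This is the determinant of the system; distinct nonnegative values have distinct
    squares.\<close>
  have sq: "complex_of_real (s i) ^ 2 - complex_of_real (s j) ^ 2 \<noteq> 0" if "s i \<noteq> s j" for i j
  proof -
    have "s i \<ge> 0" "s j \<ge> 0" using pos zero by (metis less_eq_real_def not_less)+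
    then have "s i ^ 2 \<noteq> s j ^ 2" using that by (simp add: power2_eq_iff_nonneg)
    then have "complex_of_real (s i ^ 2 - s j ^ 2) \<noteq> 0" by (simp only: of_real_eq_0_iff)
    then show ?thesis by simp
  qed
  have neq: "Z $$ (i, j) = 0" if ij: "i < m" "j < n" "s i \<noteq> s j" for i j
  proof -
    have "q i j = - ((s j * cnj (Y $$ (j, i)) + s i * Y $$ (i, j)) / (s i ^ 2 - s j ^ 2))"
      unfolding q_def using ij(3) by (simp add: minus[of _ "(complex_of_real (s j))\<^sup>2"])
    moreover have "x * - ((y * b + x * a) / e) + a + (x * b + y * a) / e * y = 0"
      if "e \<noteq> 0" "e = x\<^sup>2 - y\<^sup>2" for a b e x y :: complex
    proof -
      have "x * - ((y * b + x * a) / e) + a + (x * b + y * a) / e * y =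
        (a * e - (x * (y * b + x * a) - (x * b + y * a) * y)) / e"
        using that(1) by (simp add: field_simps)
      then show ?thesis unfolding that(2) by (simp add: algebra_simps power2_eq_square)
    qed
    ultimately show ?thesis
      unfolding Z[OF ij(1,2)] using sq[OF ij(3)] ij(3) by (simp add: p_def)
  qed
  have herm: "Z $$ (j, i) = cnj (Z $$ (i, j))" if "i < r" "j < r" for i j
  proof (cases "s i = s j")
    case True
    have "Z $$ (a, b) = (Y $$ (a, b) + cnj (Y $$ (b, a))) / 2" if "a < r" "b < r" "s a = s b" for a b
    proof -
      have "p a b * s b = (cnj (Y $$ (b, a)) - Y $$ (a, b)) / 2" "q a b = 0"
        using that pos[of b] by (simp_all add: p_def q_def)
      then show ?thesis using Z[of a b] that r by (simp add: diff_divide_distrib add_divide_distrib)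
    qed
    from this[OF that(1,2) True] this[OF that(2,1) True[symmetric]]
    have "Z $$ (i, j) = (Y $$ (i, j) + cnj (Y $$ (j, i))) / 2"
      "Z $$ (j, i) = (Y $$ (j, i) + cnj (Y $$ (i, j))) / 2" .
    then show ?thesis by (simp only: complex_cnj_divide complex_cnj_add complex_cnj_cnj
          complex_cnj_numeral add.commute)
  next
    case False
    then show ?thesis using neq[of i j] neq[of j i] that r by simp
  qed
  show ?thesis
    by (rule that[of Z, OF _ _ neq herm])
      (use X Y P Q unitarily_equivalent_infinitesimal_rotation[OF X Y P Q] in \<open>simp_all add: Z_def\<close>)
qed

text \<open>Commuting Hermitian matrices \<open>D\<close> and \<open>K\<close> are diagonalised together by diagonalising the normal
  matrix \<open>D + \<i>K\<close>.\<close>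

lemma diagonalize_appreciable_block:
  fixes K :: "complex mat" and s :: "nat \<Rightarrow> real"
  assumes K: "K \<in> carrier_mat r r" "\<And>i j. i < r \<Longrightarrow> j < r \<Longrightarrow> K $$ (j, i) = cnj (K $$ (i, j))"
    and comm: "\<And>i j. i < r \<Longrightarrow> j < r \<Longrightarrow> s i \<noteq> s j \<Longrightarrow> K $$ (i, j) = 0"
    and pos: "\<And>i. i < r \<Longrightarrow> s i > 0"
  obtains S where "unitarily_equivalent r r (dual_mat (rect_diag r r (\<lambda>i. complex_of_real (s i))) K) S"
    "S \<in> carrier_mat r r" "diagonal_mat S" "\<And>i. i < r \<Longrightarrow> positive_appreciable (S $$ (i, i))"
proof -
  define D where "D = rect_diag r r (\<lambda>i. complex_of_real (s i))"
  define N where "N = D + \<i> \<cdot>\<^sub>m K"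
  have D: "D \<in> carrier_mat r r" and hD: "ctranspose D = D"
    by (auto simp: D_def rect_diag_def intro!: eq_matI)
  have hK: "ctranspose K = K"
    by (rule eq_matI) (use K(1) in \<open>auto simp: K(2)[symmetric]\<close>)
  have d: "dim_row D = r" "dim_col D = r" "dim_row K = r" "dim_col K = r" using D K by auto
  have N: "N \<in> carrier_mat r r" using D K by (simp add: N_def)
  have "N * ctranspose N = ctranspose N * N"
  proof (rule eq_matI)
    fix i j assume "i < dim_row (ctranspose N * N)" "j < dim_col (ctranspose N * N)"
    then have ij: "i < r" "j < r" using N by auto
    let ?d = "\<lambda>i j. if i = j then complex_of_real (s i) else 0"
    let ?f = "\<lambda>k. (?d i k + \<i> * K $$ (i, k)) * (?d j k - \<i> * K $$ (k, j))"
    let ?g = "\<lambda>k. (?d k i - \<i> * K $$ (i, k)) * (?d k j + \<i> * K $$ (k, j))"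
    have cK: "cnj (K $$ (a, b)) = K $$ (b, a)" if "a < r" "b < r" for a b
      using K(2)[OF that] by simp
    \<comment> \<open>Only the commutator of \<open>D\<close> and \<open>K\<close> survives, with
      entries \<open>2 * \<i> * (s j - s i) * K $$ (i, j)\<close>; these vanish by
      \<open>comm\<close>.\<close>
    have "(\<Sum>k<r. ?f k - ?g k) =
      (\<Sum>k<r. if k = j then 2 * \<i> * K $$ (i, j) * s j else 0) -
      (\<Sum>k<r. if k = i then 2 * \<i> * s i * K $$ (i, j) else 0)"
      unfolding sum_subtractf[symmetric]
      by (intro sum.cong) (auto simp: algebra_simps)
    also have "\<dots> = 0" using comm[OF ij] ij by auto
    finally have "(\<Sum>k<r. ?f k) = (\<Sum>k<r. ?g k)" by (simp add: sum_subtractf)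
    moreover have "(N * ctranspose N) $$ (i, j) = (\<Sum>k<r. ?f k)"
      using ij d N by (simp add: scalar_prod_def lessThan_atLeast0)
        (intro sum.cong, auto simp: N_def D_def rect_diag_def cK)
    moreover have "(ctranspose N * N) $$ (i, j) = (\<Sum>k<r. ?g k)"
      using ij d N by (simp add: scalar_prod_def lessThan_atLeast0)
        (intro sum.cong, auto simp: N_def D_def rect_diag_def cK)
    ultimately show "(N * ctranspose N) $$ (i, j) = (ctranspose N * N) $$ (i, j)" by simp
  qed (use N in auto)
  from normal_unitarily_diagonalizable[OF N this] obtain W where W: "unitary_of_dim r W"
    and dW: "diagonal_mat (ctranspose W * (N * W))" by blast
  note Wd = unitary_of_dimD[OF W]
  have cW: "ctranspose W \<in> carrier_mat r r" using Wd by simp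
  define D' K' where "D' = ctranspose W * (D * W)" and "K' = ctranspose W * (K * W)"
  have d': "dim_row D' = r" "dim_col D' = r" "dim_row K' = r" "dim_col K' = r"
    using Wd d by (auto simp: D'_def K'_def)
  have "ctranspose D' = D'" "ctranspose K' = K'"
    using Wd(2,3) d by (simp_all add: D'_def K'_def ctranspose_mult mult_assoc_dim hD hK)
  then have herm: "cnj (D' $$ (i, j)) = D' $$ (j, i)" "cnj (K' $$ (i, j)) = K' $$ (j, i)"
    if "i < r" "j < r" for i j
    using that d' index_ctranspose[of j D' i] index_ctranspose[of j K' i] by auto
  have "N * W = D * W + \<i> \<cdot>\<^sub>m (K * W)"
    unfolding N_def using add_mult_distrib_mat[OF D _ Wd(1), of "\<i> \<cdot>\<^sub>m K"] K(1) Wd(1)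
    by (simp add: mult_smult_assoc_mat)
  then have "ctranspose W * (N * W) = D' + \<i> \<cdot>\<^sub>m K'"
    using mult_add_distrib_mat[OF cW, of "D * W" r "\<i> \<cdot>\<^sub>m (K * W)"] D K(1) Wd(1) cW
      mult_smult_distrib[OF cW, of "K * W" r \<i>]
    by (simp add: D'_def K'_def)
  then have off: "D' $$ (i, j) + \<i> * K' $$ (i, j) = 0" if "i < r" "j < r" "i \<noteq> j" for i j
    using dW that d' by (auto simp: diagonal_mat_def)
  \<comment> \<open>Conjugating the relation at \<open>(j, i)\<close> turns it into
    \<open>D' - \<i> K' = 0\<close> at \<open>(i, j)\<close>; together with the relation at
    \<open>(i, j)\<close> both entries vanish.\<close>
  have diag: "D' $$ (i, j) = 0 \<and> K' $$ (i, j) = 0" if "i < r" "j < r" "i \<noteq> j" for i j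
    using off[OF that] off[OF that(2,1)] that herm[OF that(1,2), symmetric]
    by (simp add: complex_eq_iff)
  have pos': "Re (D' $$ (i, i)) > 0" if i: "i < r" for i
  proof -
    \<comment> \<open>The diagonal entry is the sum of the \<open>s k\<close> weighted by the
      squared moduli in a column of \<open>W\<close>, and a column of a unitary matrix is
      nonzero.\<close>
    have "D' $$ (i, i) = (\<Sum>k<r. cnj (W $$ (k, i)) * (D * W) $$ (k, i))"
      using i Wd d by (simp add: D'_def scalar_prod_def lessThan_atLeast0)
    also have "\<dots> = (\<Sum>k<r. complex_of_real (s k * cmod (W $$ (k, i)) ^ 2))"
      using i index_rect_diag_mult[OF Wd(1) _ i]
      by (intro sum.cong) (auto simp: D_def complex_norm_square mult_ac simp del: of_real_power)
    finally have eq: "Re (D' $$ (i, i)) = (\<Sum>k<r. s k * cmod (W $$ (k, i)) ^ 2)" by simp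
    have "\<exists>k<r. W $$ (k, i) \<noteq> 0"
    proof (rule ccontr)
      assume "\<not> ?thesis"
      then have "(ctranspose W * W) $$ (i, i) = 0"
        using i Wd(2,3) by (simp add: scalar_prod_def)
      then show False using Wd(4) i by simp
    qed
    then obtain k where "k < r" "W $$ (k, i) \<noteq> 0" by blast
    then show ?thesis
      unfolding eq using pos by (intro sum_pos2[of _ k]) (auto simp: less_imp_le)
  qed
  show ?thesis
  proof (rule that)
    show "unitarily_equivalent r r (dual_mat (rect_diag r r (\<lambda>i. complex_of_real (s i))) K) (dual_mat D' K')"
      unfolding D'_def K'_def D_def[symmetric]
      by (rule unitarily_equivalent_dual_mat[OF D K(1) unitary_of_dim_ctranspose[OF W] W])
    show "dual_mat D' K' \<in> carrier_mat r r" using d' by (intro carrier_matI) auto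
    show "diagonal_mat (dual_mat D' K')"
      using diag d' by (auto simp: diagonal_mat_def zero_dual_complex_def)
    show "positive_appreciable (dual_mat D' K' $$ (i, i))" if "i < r" for i
      using that d' herm[OF that that] pos'[OF that]
      by (auto simp: positive_appreciable_def is_dual_number_def Reals_cnj_iff)
  qed
qed

theorem dual_svd_exists:
  assumes A: "A \<in> carrier_mat m n"
  shows "\<exists>r U S1 S2 V. dual_svd A r U S1 S2 V"
proof -
  define As Ad where "As = map_mat std_part A" and "Ad = map_mat inf_part A"
  have As: "As \<in> carrier_mat m n" and Ad: "Ad \<in> carrier_mat m n" using A by (auto simp: As_def Ad_def)
  have A_eq: "A = dual_mat As Ad" by (simp add: As_def Ad_def dual_mat_std_inf)
  obtain s r where r: "r \<le> m" "r \<le> n" and s: "\<forall>i<r. s i > 0" "\<forall>i\<ge>r. s i = 0"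
    and "unitarily_equivalent m n As (rect_diag m n (\<lambda>i. complex_of_real (s i)))"
    using complex_svd[OF As] by blast
  then obtain U V where UV: "unitary_of_dim m U" "unitary_of_dim n V"
    and X: "rect_diag m n (\<lambda>i. complex_of_real (s i)) = U * (As * V)"
    unfolding unitarily_equivalent_def by blast
  define X Y where "X = rect_diag m n (\<lambda>i. complex_of_real (s i))" and "Y = U * (Ad * V)"
  have Y: "Y \<in> carrier_mat m n"
    using unitary_of_dimD(1)[OF UV(1)] unitary_of_dimD(1)[OF UV(2)] Ad by (auto simp: Y_def)
  have "unitarily_equivalent m n A (dual_mat X Y)"
    unfolding A_eq X_def X Y_def by (rule unitarily_equivalent_dual_mat[OF As Ad UV])
  also obtain Z where Z: "Z \<in> carrier_mat m n" "unitarily_equivalent m n (dual_mat X Y) (dual_mat X Z)"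
    "\<And>i j. i < m \<Longrightarrow> j < n \<Longrightarrow> s i \<noteq> s j \<Longrightarrow> Z $$ (i, j) = 0"
    "\<And>i j. i < r \<Longrightarrow> j < r \<Longrightarrow> Z $$ (j, i) = cnj (Z $$ (i, j))"
    using decouple_perturbation[OF Y r, of s] s unfolding X_def by metis
  note Z(2)
  also define K L where "K = mat r r (\<lambda>(i, j). Z $$ (i, j))"
    and "L = mat (m - r) (n - r) (\<lambda>(i, j). Z $$ (i + r, j + r))"
  have "dual_mat X Z = block_diag (dual_mat (rect_diag r r (\<lambda>i. complex_of_real (s i))) K)
      (dual_mat (0\<^sub>m (m - r) (n - r)) L)"
  proof (rule eq_matI)
    fix i j
    assume "i < dim_row (block_diag (dual_mat (rect_diag r r (\<lambda>i. complex_of_real (s i))) K)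
        (dual_mat (0\<^sub>m (m - r) (n - r)) L))"
      "j < dim_col (block_diag (dual_mat (rect_diag r r (\<lambda>i. complex_of_real (s i))) K)
        (dual_mat (0\<^sub>m (m - r) (n - r)) L))"
    then have ij: "i < m" "j < n" using r by (simp_all add: rect_diag_def)
    \<comment> \<open>A positive and a zero singular value differ, so \<open>Z\<close> vanishes on
      both off-diagonal blocks.\<close>
    have "s i \<noteq> s j" if "i < r \<and> r \<le> j \<or> j < r \<and> r \<le> i"
      using that s by (metis less_irrefl)
    then show "dual_mat X Z $$ (i, j) = block_diag (dual_mat (rect_diag r r (\<lambda>i. complex_of_real (s i))) K)
        (dual_mat (0\<^sub>m (m - r) (n - r)) L) $$ (i, j)"
      using ij r Z(3)[OF ij] s
      by (auto simp: X_def rect_diag_def index_block_diag K_def L_def zero_dual_complex_def not_less)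
  qed (use r in \<open>auto simp: X_def rect_diag_def\<close>)
  also obtain S1 where S1:
    "unitarily_equivalent r r (dual_mat (rect_diag r r (\<lambda>i. complex_of_real (s i))) K) S1"
    "S1 \<in> carrier_mat r r" "diagonal_mat S1" "\<And>i. i < r \<Longrightarrow> positive_appreciable (S1 $$ (i, i))"
  proof (rule diagonalize_appreciable_block[of K r s])
    show "K $$ (j, i) = cnj (K $$ (i, j))" if "i < r" "j < r" for i j
      using Z(4)[OF that] that by (simp add: K_def)
    show "K $$ (i, j) = 0" if "i < r" "j < r" "s i \<noteq> s j" for i j
      using Z(3) that r by (simp add: K_def)
  qed (use s in \<open>auto simp: K_def\<close>)
  \<comment> \<open>The lower block is purely infinitesimal, so a complex decomposition of
    \<open>L\<close> already diagonalises it, with positive infinitesimal or zero entries.\<close>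
  have L: "L \<in> carrier_mat (m - r) (n - r)" by (simp add: L_def)
  obtain t k where t: "\<forall>i<k. t i > 0" "\<forall>i\<ge>k. t i = 0"
    and "unitarily_equivalent (m - r) (n - r) L (rect_diag (m - r) (n - r) (\<lambda>i. complex_of_real (t i)))"
    using complex_svd[OF L] by blast
  then obtain U2 V2 where UV2: "unitary_of_dim (m - r) U2" "unitary_of_dim (n - r) V2"
    and L2: "rect_diag (m - r) (n - r) (\<lambda>i. complex_of_real (t i)) = U2 * (L * V2)"
    unfolding unitarily_equivalent_def by blast
  define S2 where "S2 = dual_mat (0\<^sub>m (m - r) (n - r)) (rect_diag (m - r) (n - r) (\<lambda>i. complex_of_real (t i)))"
  have "unitarily_equivalent (m - r) (n - r) (dual_mat (0\<^sub>m (m - r) (n - r)) L) S2"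
    using unitarily_equivalent_dual_mat[OF zero_carrier_mat L UV2] unitary_of_dimD[OF UV2(1)]
      unitary_of_dimD[OF UV2(2)]
    unfolding S2_def L2 by simp
  from unitarily_equivalent_block_diag[OF S1(1) this] r
  have "unitarily_equivalent m n (block_diag (dual_mat (rect_diag r r (\<lambda>i. complex_of_real (s i))) K)
      (dual_mat (0\<^sub>m (m - r) (n - r)) L)) (block_diag S1 S2)" by simp
  finally obtain U3 V3 where UV3: "unitary_of_dim m U3" "unitary_of_dim n V3"
    and B: "block_diag S1 S2 = U3 * (A * V3)"
    unfolding unitarily_equivalent_def by blast
  note Ud = unitary_of_dimD[OF UV3(1)] and Vd = unitary_of_dimD[OF UV3(2)]
  have dA: "dim_row A = m" "dim_col A = n" using A by auto
  have dS: "dim_row S1 = r" "dim_col S1 = r" using S1(2) by auto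
  have S2c: "S2 \<in> carrier_mat (m - r) (n - r)" by (simp add: S2_def dual_mat_carrier)
  have "A = ctranspose U3 * block_diag S1 S2 * ctranspose V3"
    unfolding B using Ud Vd dA by (simp add: mult_assoc_dim)
  moreover have "diagonal_mat S2"
    by (auto simp: S2_def diagonal_mat_def rect_diag_def zero_dual_complex_def)
  moreover have "positive_infinitesimal (S2 $$ (i, i)) \<or> S2 $$ (i, i) = 0" if "i < min (m - r) (n - r)" for i
    using that t by (cases "i < k")
      (auto simp: S2_def rect_diag_def positive_infinitesimal_def is_dual_number_def zero_dual_complex_def)
  ultimately have "dual_svd A r (ctranspose U3) S1 S2 V3"
    using r S1 S2c dS dA Ud Vd unfolding dual_svd_def unitary_mat_def block_diag_def by (auto simp: Let_def)
  then show ?thesis by blast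
qed

section \<open>The inverse in terms of the decomposition\<close>

lemma infinitesimal_mult: "std_part x = 0 \<Longrightarrow> std_part y = 0 \<Longrightarrow> x * y = 0"
  by (simp add: times_dual_complex_def zero_dual_complex_def)

lemma infinitesimal_mat_mult:
  fixes A B :: "dual_complex mat"
  assumes "\<And>i j. i < dim_row A \<Longrightarrow> j < dim_col A \<Longrightarrow> std_part (A $$ (i, j)) = 0"
    and "\<And>i j. i < dim_row B \<Longrightarrow> j < dim_col B \<Longrightarrow> std_part (B $$ (i, j)) = 0"
    and "dim_col A = dim_row B"
  shows "A * B = 0\<^sub>m (dim_row A) (dim_col B)"
  by (rule eq_matI)
    (use assms in \<open>auto simp: scalar_prod_def infinitesimal_mult intro!: sum.neutral\<close>)

lemma rect_diag_mult_rect_diag: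
  fixes d e :: "nat \<Rightarrow> 'a::semiring_0"
  shows "rect_diag r r d * rect_diag r r e = rect_diag r r (\<lambda>i. d i * e i)"
proof (rule eq_matI)
  fix i j assume "i < dim_row (rect_diag r r (\<lambda>i. d i * e i))" "j < dim_col (rect_diag r r (\<lambda>i. d i * e i))"
  then have ij: "i < r" "j < r" by (auto simp: rect_diag_def)
  have "(rect_diag r r d * rect_diag r r e) $$ (i, j) =
    (\<Sum>k<r. (if i = k then d i else 0) * (if k = j then e k else 0))"
    using ij by (simp add: rect_diag_def scalar_prod_def lessThan_atLeast0)
  also have "\<dots> = (\<Sum>k<r. if i = k then (if i = j then d i * e i else 0) else 0)"
    by (intro sum.cong) auto
  also have "\<dots> = rect_diag r r (\<lambda>i. d i * e i) $$ (i, j)"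
    using ij by (simp add: rect_diag_def)
  finally show "(rect_diag r r d * rect_diag r r e) $$ (i, j) = rect_diag r r (\<lambda>i. d i * e i) $$ (i, j)" .
qed (simp_all add: rect_diag_def)

lemma positive_appreciable_unit:
  assumes "positive_appreciable x"
  obtains y where "x * y = 1"
proof -
  have "std_part x \<noteq> 0" using assms by (auto simp: positive_appreciable_def)
  \<comment> \<open>The geometric series for \<open>1 / (a + b \<epsilon>)\<close> stops after the
    linear term: \<open>1 / a - (b / a\<^sup>2) \<epsilon>\<close>.\<close>
  then have "x * Dual (1 / std_part x) (- inf_part x / (std_part x)\<^sup>2) = 1"
    by (simp add: times_dual_complex_def one_dual_complex_def field_simps power2_eq_square)
  then show ?thesis by (rule that)
qed

lemma appreciable_diagonal_inverse:
  assumes S: "S \<in> carrier_mat r r" "diagonal_mat S"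
    and pos: "\<forall>i<r. positive_appreciable (S $$ (i, i))"
  obtains T where "T \<in> carrier_mat r r" "S * T = 1\<^sub>m r" "T * S = 1\<^sub>m r"
proof -
  have "\<forall>i. \<exists>y. i < r \<longrightarrow> S $$ (i, i) * y = 1"
    using pos positive_appreciable_unit by metis
  then obtain y where y: "\<And>i. i < r \<Longrightarrow> S $$ (i, i) * y i = 1" by metis
  have Sd: "S = rect_diag r r (\<lambda>i. S $$ (i, i))"
    by (rule eq_matI) (use S in \<open>auto simp: rect_diag_def diagonal_mat_def\<close>)
  have one: "rect_diag r r (\<lambda>i. S $$ (i, i) * y i) = 1\<^sub>m r"
    by (rule eq_matI) (auto simp: rect_diag_def y)
  show ?thesis
  proof (rule that[of "rect_diag r r y"])
    show "S * rect_diag r r y = 1\<^sub>m r"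
      using rect_diag_mult_rect_diag[of r "\<lambda>i. S $$ (i, i)" y] unfolding one Sd[symmetric] .
    show "rect_diag r r y * S = 1\<^sub>m r"
      using rect_diag_mult_rect_diag[of r y "\<lambda>i. S $$ (i, i)"]
      unfolding mult.commute[of "y _"] one Sd[symmetric] .
  qed simp
qed

text \<open>The witness inverts \<open>S1\<close> and annihilates the block of \<open>S2\<close>.
  The middle factor \<open>B\<close> then differs from \<open>B * Y * B\<close> only in the block
  \<open>S2\<close>, which disappears after multiplication by the adjoint because products of
  infinitesimals are zero.\<close>

lemma dual_svd_weak_mp_inverse:
  assumes svd: "dual_svd A r U S1 S2 V"
  obtains X where "weak_mp_inverse A X"
    "A * X * A = U * four_block_mat S1 (0\<^sub>m r (dim_col A - r)) (0\<^sub>m (dim_row A - r) r)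
              (0\<^sub>m (dim_row A - r) (dim_col A - r)) * ctranspose V"
proof -
  define m n where "m = dim_row A" and "n = dim_col A"
  note svd = svd[unfolded dual_svd_def Let_def, folded m_def n_def]
  have r: "r \<le> m" "r \<le> n" and cU: "U \<in> carrier_mat m m" and cV: "V \<in> carrier_mat n n"
    and uU: "unitary_mat U" and uV: "unitary_mat V"
    and S1: "S1 \<in> carrier_mat r r" "diagonal_mat S1" "\<forall>i<r. positive_appreciable (S1 $$ (i, i))"
    and S2: "S2 \<in> carrier_mat (m - r) (n - r)" "diagonal_mat S2"
      "\<forall>i<min (m - r) (n - r). positive_infinitesimal (S2 $$ (i, i)) \<or> S2 $$ (i, i) = 0"
    and A: "A = U * four_block_mat S1 (0\<^sub>m r (n - r)) (0\<^sub>m (m - r) r) S2 * ctranspose V"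
    using svd by blast+
  have U: "unitary_of_dim m U" and V: "unitary_of_dim n V"
    using uU uV cU cV by (auto simp: unitary_mat_def unitary_of_dim_def)
  note Ud = unitary_of_dimD[OF U] and Vd = unitary_of_dimD[OF V]
  have d [simp]: "dim_row S1 = r" "dim_col S1 = r" "dim_row S2 = m - r" "dim_col S2 = n - r"
    using S1 S2 by auto
  have s2: "std_part (S2 $$ (i, j)) = 0" if "i < m - r" "j < n - r" for i j
    using that S2(2,3) by (cases "i = j")
      (auto simp: diagonal_mat_def positive_infinitesimal_def zero_dual_complex_def)
  have S2_sq: "ctranspose S2 * S2 = 0\<^sub>m (n - r) (n - r)" "S2 * ctranspose S2 = 0\<^sub>m (m - r) (m - r)"
    using infinitesimal_mat_mult[of "ctranspose S2" S2] infinitesimal_mat_mult[of S2 "ctranspose S2"]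
    by (simp_all add: s2 conjugate_dual_complex_def)
  define B where "B = block_diag S1 S2"
  have AB: "A = U * (B * ctranspose V)"
    unfolding A B_def block_diag_def using Ud Vd r by (simp add: mult_assoc_dim)
  obtain T where T: "T \<in> carrier_mat r r" "S1 * T = 1\<^sub>m r" "T * S1 = 1\<^sub>m r"
    using appreciable_diagonal_inverse[OF S1] by metis
  have dT [simp]: "dim_row T = r" "dim_col T = r" using T(1) by auto
  define Y where "Y = block_diag T (0\<^sub>m (n - r) (m - r))"
  have dB [simp]: "dim_row B = m" "dim_col B = n" "dim_row Y = n" "dim_col Y = m"
    using r by (auto simp: B_def Y_def)
  have BY: "B * Y = block_diag (1\<^sub>m r) (0\<^sub>m (m - r) (m - r))"
    and YB: "Y * B = block_diag (1\<^sub>m r) (0\<^sub>m (n - r) (n - r))"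
    by (simp_all add: B_def Y_def block_diag_mult T)
  have Y1: "Y * (B * Y) = Y" unfolding BY by (simp add: Y_def block_diag_mult)
  have Y2: "ctranspose (B * Y) = B * Y" unfolding BY by (simp add: block_diag_ctranspose)
  have Y3: "ctranspose (Y * B) = Y * B" unfolding YB by (simp add: block_diag_ctranspose)
  have Y4: "ctranspose B * (B * (Y * B)) = ctranspose B * B"
    unfolding YB by (simp add: B_def block_diag_mult block_diag_ctranspose S2_sq)
  have Y5: "B * (Y * (B * ctranspose B)) = B * ctranspose B"
  proof -
    have "B * (Y * (B * ctranspose B)) = (B * Y) * (B * ctranspose B)" by (simp add: mult_assoc_dim)
    also have "\<dots> = B * ctranspose B"
      unfolding BY by (simp add: B_def block_diag_mult block_diag_ctranspose S2_sq)
    finally show ?thesis .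
  qed
  have e2: "ctranspose Y * ctranspose B = B * Y" and e3: "ctranspose B * ctranspose Y = Y * B"
    using Y2 Y3 by (simp_all add: ctranspose_mult)
  \<comment> \<open>Variants with a trailing factor, as in \<open>mult_eqs_left\<close>, here for
    the middle factor \<open>B\<close> enclosed between unitary matrices.\<close>
  have l: "Y * (B * (Y * Z)) = Y * Z" "ctranspose Y * (ctranspose B * Z) = B * (Y * Z)" if "dim_row Z = m" for Z
    using arg_cong[OF Y1, of "\<lambda>M. M * Z"] arg_cong[OF e2, of "\<lambda>M. M * Z"] that
    by (simp_all add: mult_assoc_dim)
  have l': "ctranspose B * (ctranspose Y * Z) = Y * (B * Z)"
    "ctranspose B * (B * (Y * (B * Z))) = ctranspose B * (B * Z)" if "dim_row Z = n" for Z
    using arg_cong[OF e3, of "\<lambda>M. M * Z"] arg_cong[OF Y4, of "\<lambda>M. M * Z"] that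
    by (simp_all add: mult_assoc_dim)
  have l'': "B * (Y * (B * (ctranspose B * Z))) = B * (ctranspose B * Z)" if "dim_row Z = m" for Z
    using arg_cong[OF Y5, of "\<lambda>M. M * Z"] that by (simp add: mult_assoc_dim)
  have "weak_mp_inverse A (V * (Y * ctranspose U))"
    unfolding weak_mp_inverse_def
    by (intro conjI carrier_matI)
      (simp_all add: AB ctranspose_mult mult_assoc_dim Ud Vd l l' l'')
  moreover have "A * (V * (Y * ctranspose U)) * A = U * (B * (Y * B)) * ctranspose V"
    by (simp add: AB mult_assoc_dim Ud Vd)
  moreover have "B * (Y * B) = block_diag S1 (0\<^sub>m (m - r) (n - r))"
    unfolding YB by (simp add: B_def block_diag_mult)
  ultimately show ?thesis
    using that[unfolded m_def[symmetric] n_def[symmetric], of "V * (Y * ctranspose U)"]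
    by (simp add: block_diag_def)
qed

section \<open>Identification of the essential part and of the inverse\<close>

text \<open>Every decomposition yields a weak inverse whose \<open>A * X * A\<close> is its
  candidate for the essential part. Uniqueness of the weak inverse makes all candidates equal, and
  existence of a decomposition makes the definite description meaningful.\<close>

lemma essential_part_eq:
  assumes "weak_mp_inverse A X"
  shows "essential_part A = A * X * A"
proof -
  let ?ess = "\<lambda>r U S1 V. U * four_block_mat S1 (0\<^sub>m r (dim_col A - r)) (0\<^sub>m (dim_row A - r) r)
              (0\<^sub>m (dim_row A - r) (dim_col A - r)) * ctranspose V"
  have eq: "?ess r U S1 V = A * X * A" if "dual_svd A r U S1 S2 V" for r U S1 S2 V
    using dual_svd_weak_mp_inverse[OF that] weak_mp_inverse_unique[OF assms] by metis
  obtain r U S1 S2 V where "dual_svd A r U S1 S2 V"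
    using dual_svd_exists[of A] by blast
  then show ?thesis
    unfolding essential_part_def using eq by (intro the_equality) metis+
qed

text \<open>For a competitor \<open>Y\<close> the first Penrose equation now reads
  \<open>A * Y * A = A * X * A\<close>. This common value takes the place of \<open>A\<close> in the
  classical uniqueness argument.\<close>

lemma ndmpi_eq:
  assumes "weak_mp_inverse A X"
  shows "ndmpi A = X"
  unfolding ndmpi_def
proof (rule the_equality)
  show X: "is_ndmpi A X"
    using assms by (simp add: is_ndmpi_def weak_mp_inverse_def essential_part_eq[OF assms])
  fix Y assume Y: "is_ndmpi A Y"
  obtain m n where A: "A \<in> carrier_mat m n" by blast
  have dims: "dim_row A = m" "dim_col A = n" "dim_row X = n" "dim_col X = m" "dim_row Y = n" "dim_col Y = m"
    using X Y A by (auto simp: is_ndmpi_def)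
  have a: "A * (Y * A) = A * (X * A)" "X * (A * X) = X" "Y * (A * Y) = Y"
    and h: "ctranspose X * ctranspose A = A * X" "ctranspose A * ctranspose X = X * A"
      "ctranspose Y * ctranspose A = A * Y" "ctranspose A * ctranspose Y = Y * A"
    using X Y by (simp_all add: is_ndmpi_def mult_assoc_dim dims ctranspose_mult)
  have al: "A * (Y * (A * Z)) = A * (X * (A * Z))" if "dim_row Z = n" for Z
    using arg_cong[OF a(1), of "\<lambda>M. M * Z"] that by (simp add: mult_assoc_dim dims)
  have l: "A * X = A * (Y * (A * X))" using al[of X] a(2) dims by simp
  have r: "X * A = X * (A * (Y * A))"
    unfolding a(1) using arg_cong[OF a(2), of "\<lambda>M. M * A"] by (simp add: mult_assoc_dim dims)
  have AXY: "A * X = A * Y"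
  proof -
    have "A * X = ctranspose (A * (Y * (A * X)))"
      unfolding l[symmetric] by (simp add: ctranspose_mult dims h)
    also have "\<dots> = A * X * (A * Y)" by (simp add: ctranspose_mult mult_assoc_dim dims h)
    also have "\<dots> = A * Y" using al[of Y] a(3) by (simp add: mult_assoc_dim dims)
    finally show ?thesis .
  qed
  have XAY: "X * A = Y * A"
  proof -
    have "X * A = ctranspose (X * (A * (Y * A)))"
      unfolding r[symmetric] by (simp add: ctranspose_mult dims h)
    also have "\<dots> = Y * A * (X * A)" by (simp add: ctranspose_mult mult_assoc_dim dims h)
    also have "\<dots> = Y * (A * (Y * A))" by (simp add: mult_assoc_dim dims a(1))
    also have "\<dots> = Y * A" using arg_cong[OF a(3), of "\<lambda>M. M * A"] by (simp add: mult_assoc_dim dims)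
    finally show ?thesis .
  qed
  have "Y = Y * A * Y" by (simp add: mult_assoc_dim dims a)
  also have "\<dots> = X * (A * X)" unfolding XAY[symmetric] by (simp add: mult_assoc_dim dims AXY)
  finally show "Y = X" by (simp add: a)
qed

lemma weak_mp_inverse_ndmpi: "weak_mp_inverse A (ndmpi A)"
proof -
  obtain r U S1 S2 V where "dual_svd A r U S1 S2 V" using dual_svd_exists[of A] by blast
  then obtain X where "weak_mp_inverse A X" using dual_svd_weak_mp_inverse by metis
  then show ?thesis using ndmpi_eq by metis
qed

theorem theorem3p4:
  fixes A B :: "dual_complex mat" and m q n :: nat
  assumes "A \<in> carrier_mat m q"
    and "B \<in> carrier_mat q n"
    and "ndmpi A * A * B * ctranspose B * ctranspose A = B * ctranspose B * ctranspose A"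
    and "B * ndmpi B * ctranspose A * A * B = ctranspose A * A * B"
  shows "ndmpi (A * B) = ndmpi B * ndmpi A"
  by (rule ndmpi_eq) (rule weak_mp_inverse_mult[OF assms(1,2) weak_mp_inverse_ndmpi weak_mp_inverse_ndmpi assms(3,4)])

end
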